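(* Let $A\in\mathbb{R}^{n\times n}$, $N\ge1$, $\sigma>0$, let $W_o=\sum_{k=0}^{N-1}(A^k)^\top A^k$ be the observability Gramian with $C=I$, and let $W_o\succ0$. Consider the measurements $y[k]=x[k]+v[k]$, $k=0,\dots,N-1$, where $x[k+1]=Ax[k]$ and $v[0],\dots,v[N-1]$ are jointly Gaussian, zero mean, mutually uncorrelated, each with covariance $\sigma^2I$. Let $\widehat x[0]$ be the least squares estimate of $x[0]$ from these measurements, define the estimation error $\widetilde x[0]:=\widehat x[0]-x[0]$, and let $\Sigma:=\sigma^2W_o^{-1}$ denote its covariance. Then for every $Y\subseteq\mathcal{Y}=\{1,\dots,n\}$ with complement $\bar Y=\mathcal{Y}\setminus Y$, $$\det\big((W_o)_Y\big)=\det(W_o)\,\det\big((W_o^{-1})_{\bar Y}\big),$$ and the error covariance of $\widetilde x_Y[0]$ conditioned on $\widetilde x_{\bar Y}[0]$ is $$\mathrm{cov}\big(\widetilde x_Y[0]\mid\widetilde x_{\bar Y}[0]\big)=\sigma^2\big((W_o)_Y\big)^{-1}.$$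
   Context: For a matrix $M$ and an index set $S$, $M_S=[M_{ij}]_{i,j\in S}$ is the principal submatrix, with $\det(M_\emptyset)=1$; for a vector $z$, $z_S$ is the subvector of entries indexed by $S$. The initial state $x[0]$ is a fixed unknown vector. Stacking the measurements gives $\mathbf{y}=Ox[0]+\eta$ with $O=[I,A^\top,\dots,(A^{N-1})^\top]^\top$, $W_o=O^\top O$, and the least squares estimate is the minimizer of $\|\mathbf{y}-Oz\|^2$ over $z\in\mathbb{R}^n$. The conditional covariance refers to the jointly Gaussian vector $\widetilde x[0]$ partitioned according to $Y$ and $\bar Y$. *)

theory Defs
  imports
    "HOL-Probability.Probability"
    "Jordan_Normal_Form.Determinant"
    "Jordan_Normal_Form.Gauss_Jordan_Elimination"
    "Jordan_Normal_Form.DL_Submatrix"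
begin

unbundle no vec_syntax
unbundle no inner_syntax

hide_const (open) Finite_Cartesian_Product.vec Finite_Cartesian_Product.mat
  Finite_Cartesian_Product.row Finite_Cartesian_Product.column
  Determinants.det

text \<open>Indices run over \<open>{0..<n}\<close> rather than \<open>{1..n}\<close>.\<close>

definition positive_definite :: "nat \<Rightarrow> real mat \<Rightarrow> bool" where
  "positive_definite n M \<longleftrightarrow>
     M \<in> carrier_mat n n \<and> M\<^sup>T = M \<and>
     (\<forall>z \<in> carrier_vec n. z \<noteq> 0\<^sub>v n \<longrightarrow> z \<bullet> (M *\<^sub>v z) > 0)"

text \<open>Unspecified on singular matrices.\<close>

definition mat_inv :: "real mat \<Rightarrow> real mat" where
  "mat_inv M = the (mat_inverse M)"

text \<open>The rows and columns with index in \<open>S\<close>, in increasing order, renumbered from 0;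
  \<open>pick S i\<close> is the element of \<open>S\<close> having exactly \<open>i\<close> predecessors in \<open>S\<close>.
  For empty \<open>S\<close> this is the 0-by-0 matrix, whose determinant is 1.\<close>

definition principal_submatrix :: "real mat \<Rightarrow> nat set \<Rightarrow> real mat" where
  "principal_submatrix M S = submatrix M S S"

definition subvec :: "real vec \<Rightarrow> nat set \<Rightarrow> real vec" where
  "subvec z S = vec (card S) (\<lambda>i. z $ pick S i)"

definition mean_vec :: "'a measure \<Rightarrow> nat \<Rightarrow> ('a \<Rightarrow> real vec) \<Rightarrow> real vec" where
  "mean_vec M p X = vec p (\<lambda>i. \<integral>\<omega>. X \<omega> $ i \<partial>M)"

definition cov_mat ::
  "'a measure \<Rightarrow> nat \<Rightarrow> ('a \<Rightarrow> real vec) \<Rightarrow> ('a \<Rightarrow> real vec) \<Rightarrow> real mat" where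
  "cov_mat M p X Z = mat p p (\<lambda>(i, j).
     \<integral>\<omega>. (X \<omega> $ i - mean_vec M p X $ i) * (Z \<omega> $ j - mean_vec M p Z $ j) \<partial>M)"

text \<open>Point masses count as (degenerate) Gaussian distributions.\<close>

definition gaussian_rv :: "'a measure \<Rightarrow> ('a \<Rightarrow> real) \<Rightarrow> bool" where
  "gaussian_rv M X \<longleftrightarrow> X \<in> borel_measurable M \<and>
     ((\<exists>\<mu> s. s > 0 \<and> distributed M lborel X (normal_density \<mu> s)) \<or>
      (\<exists>c. AE \<omega> in M. X \<omega> = c))"

definition jointly_gaussian :: "'a measure \<Rightarrow> 'i set \<Rightarrow> ('i \<Rightarrow> 'a \<Rightarrow> real) \<Rightarrow> bool" where
  "jointly_gaussian M I X \<longleftrightarrow>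
     (\<forall>c :: 'i \<Rightarrow> real. gaussian_rv M (\<lambda>\<omega>. \<Sum>i\<in>I. c i * X i \<omega>))"

text \<open>The \<open>\<sigma>\<close>-algebra on the sample space generated by the entries of the \<open>q\<close>-dimensional
  random vector \<open>Z\<close>. It is the trivial one for \<open>q = 0\<close>.\<close>

definition generated_algebra :: "'a measure \<Rightarrow> nat \<Rightarrow> ('a \<Rightarrow> real vec) \<Rightarrow> 'a measure" where
  "generated_algebra M q Z =
     vimage_algebra (space M) (\<lambda>\<omega>. \<lambda>j\<in>{..<q}. Z \<omega> $ j) (\<Pi>\<^sub>M j\<in>{..<q}. (borel :: real measure))"

text \<open>\<open>cov(X | Z) = E[(X - E[X | Z]) (X - E[X | Z])\<^sup>T | Z]\<close>. It is a random
  matrix, and as a conditional expectation it is determined only almost everywhere.\<close>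

definition cond_cov ::
  "'a measure \<Rightarrow> nat \<Rightarrow> ('a \<Rightarrow> real vec) \<Rightarrow> nat \<Rightarrow> ('a \<Rightarrow> real vec) \<Rightarrow> 'a \<Rightarrow> real mat" where
  "cond_cov M p X q Z \<omega> =
     (let F = generated_algebra M q Z;
          D = (\<lambda>i \<omega>'. X \<omega>' $ i - real_cond_exp M F (\<lambda>\<omega>''. X \<omega>'' $ i) \<omega>')
      in mat p p (\<lambda>(i, j). real_cond_exp M F (\<lambda>\<omega>'. D i \<omega>' * D j \<omega>') \<omega>))"

definition observability_gramian :: "nat \<Rightarrow> real mat \<Rightarrow> nat \<Rightarrow> real mat" where
  "observability_gramian n A N =
     mat n n (\<lambda>(i, j). \<Sum>k<N. ((A ^\<^sub>m k)\<^sup>T * A ^\<^sub>m k) $$ (i, j))"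

text \<open>Block \<open>k\<close> of a stacked object, of height \<open>n\<close>, occupies the rows \<open>k * n, ..., k * n + n - 1\<close>.\<close>

definition stack_vec :: "nat \<Rightarrow> nat \<Rightarrow> (nat \<Rightarrow> real vec) \<Rightarrow> real vec" where
  "stack_vec n N u = vec (N * n) (\<lambda>r. u (r div n) $ (r mod n))"

definition observability_matrix :: "nat \<Rightarrow> real mat \<Rightarrow> nat \<Rightarrow> real mat" where
  "observability_matrix n A N =
     mat (N * n) n (\<lambda>(r, j). (A ^\<^sub>m (r div n)) $$ (r mod n, j))"

definition sq_norm :: "real vec \<Rightarrow> real" where
  "sq_norm u = u \<bullet> u"

definition least_squares_estimate ::
  "nat \<Rightarrow> real mat \<Rightarrow> nat \<Rightarrow> (nat \<Rightarrow> real vec) \<Rightarrow> real vec \<Rightarrow> bool" where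
  "least_squares_estimate n A N y xhat \<longleftrightarrow>
     is_arg_min (\<lambda>z. sq_norm (stack_vec n N y - observability_matrix n A N *\<^sub>v z))
                (\<lambda>z. z \<in> carrier_vec n) xhat"

end

theory Submission
  imports Defs
begin

text \<open>
  Write \<open>g = O\<^sup>T \<eta>\<close>. The normal equations say \<open>g = W\<^sub>o x\<close> for the estimation error \<open>x\<close>, so
  \<open>x = W\<^sub>o\<^sup>-\<^sup>1 g\<close> has covariance \<open>\<sigma>\<^sup>2 W\<^sub>o\<^sup>-\<^sup>1\<close> and cross covariance \<open>\<sigma>\<^sup>2 I\<close> with \<open>g\<close>. Hence
  \<open>r = ((W\<^sub>o)\<^sub>Y)\<^sup>-\<^sup>1 g\<^sub>Y\<close>, which is \<open>x\<^sub>Y\<close> plus a linear function of the complementary part of \<open>x\<close>, is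
  uncorrelated with that part, and therefore independent of it: \<open>r\<close> is the residual
  \<open>x\<^sub>Y - E[x\<^sub>Y | \<dots>]\<close>, and its conditional covariance is its covariance \<open>\<sigma>\<^sup>2 ((W\<^sub>o)\<^sub>Y)\<^sup>-\<^sup>1\<close>.

  For the determinants, let \<open>B\<close> have the columns of \<open>W\<^sub>o\<^sup>-\<^sup>1\<close> outside \<open>Y\<close> and those of the identity
  in \<open>Y\<close>. Then \<open>W\<^sub>o B\<close> has the columns of \<open>W\<^sub>o\<close> in \<open>Y\<close> and those of the identity outside,
  and \<open>det (W\<^sub>o B) = det W\<^sub>o det B\<close> is the claim.
\<close>

section \<open>Principal submatrices\<close>

text \<open>Strict monotonicity of \<open>pick S\<close> gives injectivity, and counting gives
  surjectivity. This moves sums between positions and elements of \<open>S\<close>.\<close>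

lemma bij_betw_pick:
  assumes "finite S"
  shows "bij_betw (pick S) {..<card S} S"
proof -
  have inj: "inj_on (pick S) {..<card S}"
    by (rule linorder_inj_onI) (use pick_mono in \<open>fastforce+\<close>)
  have "pick S ` {..<card S} \<subseteq> S"
    by (auto intro: pick_in_set)
  then show ?thesis
    using inj assms by (simp add: bij_betw_def card_image card_subset_eq)
qed

lemma pick_mem: "S \<subseteq> {..<n} \<Longrightarrow> i < card S \<Longrightarrow> pick S i \<in> S"
  by (simp add: pick_in_set)

lemma pick_less: "S \<subseteq> {..<n} \<Longrightarrow> i < card S \<Longrightarrow> pick S i < n"
  using pick_mem by blast

lemma pick_eq_iff:
  "finite S \<Longrightarrow> i < card S \<Longrightarrow> j < card S \<Longrightarrow> pick S i = pick S j \<longleftrightarrow> i = j"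
  using bij_betw_pick[of S] by (auto simp: bij_betw_def inj_on_def)

lemma sum_pick: "finite S \<Longrightarrow> (\<Sum>i<card S. f (pick S i)) = sum f S"
  by (rule sum.reindex_bij_betw[OF bij_betw_pick])

lemma card_less_dim: "S \<subseteq> {..<n} \<Longrightarrow> card {i. i < n \<and> i \<in> S} = card S"
  by (rule arg_cong[of _ _ card]) auto

lemma principal_submatrix_carrier:
  assumes "M \<in> carrier_mat n n" "S \<subseteq> {..<n}"
  shows "principal_submatrix M S \<in> carrier_mat (card S) (card S)"
  using assms card_less_dim[OF assms(2)]
  by (intro carrier_matI) (simp_all add: principal_submatrix_def dim_submatrix)

lemma principal_submatrix_index:
  assumes "M \<in> carrier_mat n n" "S \<subseteq> {..<n}" "i < card S" "j < card S"
  shows "principal_submatrix M S $$ (i, j) = M $$ (pick S i, pick S j)"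
  using assms card_less_dim[OF assms(2)] by (simp add: principal_submatrix_def submatrix_def)

text \<open>Permuting columns is permuting rows of the transpose. Each of the two permutations
  contributes the factor \<open>signof p\<close>, whose square is 1.\<close>

lemma det_permute_rows_columns:
  fixes A :: "'a :: comm_ring_1 mat"
  assumes A: "A \<in> carrier_mat n n" and p: "p permutes {0..<n}"
  shows "det (mat n n (\<lambda>(i, j). A $$ (p i, p j))) = det A"
proof -
  have pn: "p i < n" if "i < n" for i
    using permutes_in_image[OF p, of i] that by simp
  define B where "B = mat n n (\<lambda>(i, j). A\<^sup>T $$ (p i, j))"
  have B: "B \<in> carrier_mat n n" by (simp add: B_def)
  have "mat n n (\<lambda>(i, j). A $$ (p i, p j)) = mat n n (\<lambda>(i, j). B\<^sup>T $$ (p i, j))"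
    using A by (intro cong_mat) (auto simp: B_def pn)
  then have "det (mat n n (\<lambda>(i, j). A $$ (p i, p j))) = signof p * det (B\<^sup>T)"
    using det_permute_rows[of "B\<^sup>T" n p] B p by simp
  also have "det (B\<^sup>T) = det B" using B by (rule det_transpose)
  also have "det B = signof p * det (A\<^sup>T)"
    unfolding B_def using det_permute_rows[of "A\<^sup>T" n p] A p by simp
  also have "det (A\<^sup>T) = det A" using A by (rule det_transpose)
  finally show ?thesis by (simp add: sign_def split: if_splits)
qed

lemma det_unit_columns_off:
  assumes M: "M \<in> carrier_mat n n" and S: "S \<subseteq> {..<n}"
  shows "det (mat n n (\<lambda>(i, j). if j \<in> S then M $$ (i, j) else if i = j then 1 else 0)) =
    det (principal_submatrix M S)" (is "det ?B = _")
proof -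
  \<comment> \<open>A permutation \<open>\<pi>\<close> that lists \<open>S\<close> first makes the matrix block triangular.\<close>
  define p where "p = card S"
  define T where "T = {..<n} - S"
  have fin: "finite S" "finite T" using S finite_subset by (auto simp: T_def)
  have pn: "p \<le> n" using S card_mono[of "{..<n}" S] by (simp add: p_def)
  have cT: "card T = n - p" using S fin by (simp add: T_def p_def card_Diff_subset)
  \<comment> \<open>The last branch fixes every index from \<open>n\<close> on, as
    \<open>permutes\<close> requires; \<open>k - p\<close> restarts the count at 0 for the
    complement.\<close>
  define \<pi> where "\<pi> k = (if k < p then pick S k else if k < n then pick T (k - p) else k)" for k
  have piS: "\<pi> k \<in> S" if "k < p" for k
    using that pick_mem[OF S] by (simp add: \<pi>_def p_def)
  have piT: "\<pi> k \<in> T" if "p \<le> k" "k < n" for k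
    using that pick_mem[of T n "k - p"] cT by (auto simp: \<pi>_def T_def)
  have pi_lt: "\<pi> k < n" if "k < n" for k
    using piS[of k] piT[of k] that S by (cases "k < p") (auto simp: T_def)
  have inj: "inj_on \<pi> {0..<n}"
  proof (rule inj_onI)
    fix a b assume ab: "a \<in> {0..<n}" "b \<in> {0..<n}" and eq: "\<pi> a = \<pi> b"
    have "a < p \<longleftrightarrow> b < p"
      using piS[of a] piS[of b] piT[of a] piT[of b] ab eq by (force simp: T_def)
    then consider "a < p" "b < p" | "p \<le> a" "p \<le> b" by force
    then show "a = b"
    proof cases
      case 1
      then show ?thesis using eq pick_eq_iff[OF fin(1), of a b] by (simp add: \<pi>_def p_def)
    next
      case 2
      then show ?thesis using eq ab pick_eq_iff[OF fin(2), of "a - p" "b - p"] cT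
        by (simp add: \<pi>_def)
    qed
  qed
  have perm: "\<pi> permutes {0..<n}"
  proof (rule bij_imp_permutes)
    have "\<pi> ` {0..<n} \<subseteq> {0..<n}" using pi_lt by auto
    then show "bij_betw \<pi> {0..<n} {0..<n}"
      using inj by (simp add: bij_betw_def endo_inj_surj)
    show "\<pi> x = x" if "x \<notin> {0..<n}" for x
      using that pn by (simp add: \<pi>_def)
  qed
  \<comment> \<open>The lower left block; with a zero block at the upper right it does not enter the
    determinant.\<close>
  define X where "X = mat (n - p) p (\<lambda>(i, j). ?B $$ (\<pi> (i + p), \<pi> j))"
  have PS: "principal_submatrix M S \<in> carrier_mat p p"
    using principal_submatrix_carrier[OF M S] by (simp add: p_def)
  have "mat n n (\<lambda>(i, j). ?B $$ (\<pi> i, \<pi> j)) =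
      four_block_mat (principal_submatrix M S) (0\<^sub>m p (n - p)) X (1\<^sub>m (n - p))"
    (is "?L = ?R")
  proof (rule eq_matI)
    show "dim_row ?L = dim_row ?R" "dim_col ?L = dim_col ?R"
      using PS pn by (auto simp: X_def)
    fix i j assume ij: "i < dim_row ?R" "j < dim_col ?R"
    then have ij: "i < n" "j < n" using PS pn by auto
    show "?L $$ (i, j) = ?R $$ (i, j)"
    proof (cases "j < p")
      case True
      have "?L $$ (i, j) = M $$ (\<pi> i, \<pi> j)"
        using ij pi_lt[OF ij(1)] pi_lt[OF ij(2)] piS[OF True] by simp
      then show ?thesis
        using True ij PS pn principal_submatrix_index[OF M S, of i j]
        by (cases "i < p") (simp_all add: X_def \<pi>_def p_def)
    next
      case False
      then have "\<pi> j \<notin> S" using piT[of j] ij by (simp add: T_def)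
      moreover have "\<pi> i = \<pi> j \<longleftrightarrow> i = j" using inj ij by (auto simp: inj_on_def)
      ultimately have "?L $$ (i, j) = (if i = j then 1 else 0)"
        using ij pi_lt[OF ij(1)] pi_lt[OF ij(2)] by simp
      then show ?thesis using ij PS pn False by (cases "i < p") auto
    qed
  qed
  then have "det ?B = det ?R"
    using det_permute_rows_columns[OF _ perm, of ?B] by simp
  also have "\<dots> = det (principal_submatrix M S)"
    using PS by (subst det_four_block_mat_upper_right_zero) (auto simp: X_def)
  finally show ?thesis .
qed

section \<open>Inverse matrices and complementary principal minors\<close>

lemma mat_inv:
  assumes "M \<in> carrier_mat n n" "det M \<noteq> 0"
  shows "mat_inv M \<in> carrier_mat n n" "M * mat_inv M = 1\<^sub>m n" "mat_inv M * M = 1\<^sub>m n"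
proof -
  obtain P where "mat_inverse M = Some P"
    \<comment> \<open>A nonzero determinant makes \<open>M\<close> a unit, which excludes the
      outcome \<open>None\<close>. The argument \<open>b\<close> fills the extension slot of the
      matrix ring record, so that both facts speak of the same ring.\<close>
    using mat_inverse(1)[OF assms(1), where b = "()"]
      det_non_zero_imp_unit[OF assms, where b = "()"]
    by (cases "mat_inverse M") auto
  then show "mat_inv M \<in> carrier_mat n n" "M * mat_inv M = 1\<^sub>m n" "mat_inv M * M = 1\<^sub>m n"
    using mat_inverse(2)[OF assms(1)] by (auto simp: mat_inv_def)
qed

text \<open>A singular matrix kills a nonzero vector, on which the quadratic form would be 0 rather
  than positive.\<close>

lemma positive_definite_det_nonzero:
  assumes "positive_definite n M"
  shows "det M \<noteq> 0"
proof
  assume "det M = 0"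
  then obtain z where "z \<in> carrier_vec n" "z \<noteq> 0\<^sub>v n" "M *\<^sub>v z = 0\<^sub>v n"
    using assms det_0_iff_vec_prod_zero[of M n] by (auto simp: positive_definite_def)
  then show False using assms by (force simp: positive_definite_def)
qed

lemma mat_mult_index_sum:
  assumes "A \<in> carrier_mat n m" "B \<in> carrier_mat m k" "i < n" "j < k"
  shows "(A * B) $$ (i, j) = (\<Sum>l<m. A $$ (i, l) * B $$ (l, j))"
  using assms by (simp add: scalar_prod_def atLeast0LessThan)

lemma mat_vec_index_sum:
  assumes "A \<in> carrier_mat n m" "z \<in> carrier_vec m" "i < n"
  shows "(A *\<^sub>v z) $ i = (\<Sum>l<m. A $$ (i, l) * z $ l)"
  using assms by (simp add: scalar_prod_def atLeast0LessThan)

lemma det_principal_submatrix_complement: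
  assumes M: "M \<in> carrier_mat n n" and nz: "det M \<noteq> 0" and S: "S \<subseteq> {..<n}"
  shows "det (principal_submatrix M S) =
    det M * det (principal_submatrix (mat_inv M) ({..<n} - S))"
proof -
  note P = mat_inv[OF M nz]
  let ?T = "{..<n} - S"
  define B where "B = mat n n (\<lambda>(i, j). if j \<in> ?T then mat_inv M $$ (i, j) else if i = j then 1 else 0)"
  have B: "B \<in> carrier_mat n n" by (simp add: B_def)
  have "M * B = mat n n (\<lambda>(i, j). if j \<in> S then M $$ (i, j) else if i = j then 1 else 0)"
    (is "_ = ?R")
  proof (rule eq_matI)
    fix i j assume "i < dim_row ?R" "j < dim_col ?R"
    then have ij: "i < n" "j < n" by auto
    have "(M * B) $$ (i, j) = (\<Sum>l<n. M $$ (i, l) * B $$ (l, j))"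
      using M B ij by (rule mat_mult_index_sum)
    also have "\<dots> = ?R $$ (i, j)"
    proof (cases "j \<in> S")
      case True
      then have "(\<Sum>l<n. M $$ (i, l) * B $$ (l, j)) = (\<Sum>l<n. if l = j then M $$ (i, l) else 0)"
        using ij by (intro sum.cong) (auto simp: B_def)
      then show ?thesis using True ij by simp
    next
      case False
      then have "(\<Sum>l<n. M $$ (i, l) * B $$ (l, j)) = (\<Sum>l<n. M $$ (i, l) * mat_inv M $$ (l, j))"
        using ij by (intro sum.cong) (auto simp: B_def)
      also have "\<dots> = 1\<^sub>m n $$ (i, j)"
        using mat_mult_index_sum[OF M P(1) ij] P(2) by simp
      finally show ?thesis using False ij by simp
    qed
    finally show "(M * B) $$ (i, j) = ?R $$ (i, j)" .
  qed (use M B in auto)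
  then have "det (principal_submatrix M S) = det (M * B)"
    using det_unit_columns_off[OF M S] by simp
  also have "\<dots> = det M * det B" using M B by (rule det_mult)
  \<comment> \<open>The same reduction, with the complement in place of \<open>S\<close> and the
    inverse in place of \<open>M\<close>.\<close>
  also have "det B = det (principal_submatrix (mat_inv M) ?T)"
    unfolding B_def by (rule det_unit_columns_off[OF P(1)]) auto
  finally show ?thesis .
qed

section \<open>Positive definiteness of principal submatrices\<close>

lemma quadratic_form_sum:
  assumes "M \<in> carrier_mat n n" "z \<in> carrier_vec n"
  shows "z \<bullet> (M *\<^sub>v z) = (\<Sum>i<n. \<Sum>j<n. z $ i * M $$ (i, j) * z $ j)"
  using assms by (simp add: scalar_prod_def atLeast0LessThan sum_distrib_left mult.assoc)

text \<open>Padding a nonzero \<open>z\<close> with zeros outside \<open>S\<close> gives a nonzero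
  vector of length \<open>n\<close> with the same value of the quadratic form. This makes the
  submatrix invertible when the residual is formed.\<close>

lemma positive_definite_principal_submatrix:
  assumes pd: "positive_definite n M" and S: "S \<subseteq> {..<n}"
  shows "positive_definite (card S) (principal_submatrix M S)"
proof -
  have M: "M \<in> carrier_mat n n" and sym: "M\<^sup>T = M"
    and pos: "\<And>z. z \<in> carrier_vec n \<Longrightarrow> z \<noteq> 0\<^sub>v n \<Longrightarrow> z \<bullet> (M *\<^sub>v z) > 0"
    using pd by (auto simp: positive_definite_def)
  have fin: "finite S" using S finite_subset by auto
  note PS = principal_submatrix_carrier[OF M S]
  note idx = principal_submatrix_index[OF M S]
  have symM: "M $$ (i, j) = M $$ (j, i)" if "i < n" "j < n" for i j
    using arg_cong[OF sym, of "\<lambda>A. A $$ (j, i)"] M that by simp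
  have "(principal_submatrix M S)\<^sup>T = principal_submatrix M S"
    using PS by (intro eq_matI) (auto simp: idx symM pick_less[OF S])
  moreover have "z \<bullet> (principal_submatrix M S *\<^sub>v z) > 0"
    if z: "z \<in> carrier_vec (card S)" "z \<noteq> 0\<^sub>v (card S)" for z
  proof -
    \<comment> \<open>The position of \<open>k\<close> in \<open>S\<close> is the number of smaller
      elements of \<open>S\<close>, so this undoes the renumbering by \<open>pick S\<close>.\<close>
    define f where "f = (\<lambda>k. if k \<in> S then z $ card {a \<in> S. a < k} else 0)"
    have f: "f (pick S i) = z $ i" if "i < card S" for i
      using that by (simp add: f_def pick_mem[OF S] card_pick)
    obtain k where k: "k < card S" "z $ k \<noteq> 0"
      using z by (metis eq_vecI carrier_vecD index_zero_vec)
    have "vec n f \<noteq> 0\<^sub>v n"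
    proof
      assume "vec n f = 0\<^sub>v n"
      from arg_cong[OF this, of "\<lambda>u. u $ pick S k"] show False
        using k pick_less[OF S k(1)] f by simp
    qed
    then have "0 < vec n f \<bullet> (M *\<^sub>v vec n f)" by (intro pos) auto
    also have "\<dots> = (\<Sum>i<n. \<Sum>j<n. f i * M $$ (i, j) * f j)"
      by (simp add: quadratic_form_sum[OF M])
    also have "\<dots> = (\<Sum>i\<in>S. \<Sum>j\<in>S. f i * M $$ (i, j) * f j)"
    proof -
      have "(\<Sum>j<n. f i * M $$ (i, j) * f j) = (\<Sum>j\<in>S. f i * M $$ (i, j) * f j)" for i
        using S by (intro sum.mono_neutral_right) (auto simp: f_def)
      then show ?thesis
        using S by (simp, intro sum.mono_neutral_right) (auto simp: f_def)
    qed
    also have "\<dots> = z \<bullet> (principal_submatrix M S *\<^sub>v z)"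
      using f by (simp add: quadratic_form_sum[OF PS z(1)] idx flip: sum_pick[OF fin])
    finally show ?thesis .
  qed
  ultimately show ?thesis using PS by (simp add: positive_definite_def)
qed

section \<open>Independence from characteristic functions\<close>

text \<open>An indicator has only four possible preimages, so it generates no events beyond those
  forced by \<open>V\<close>.\<close>

lemma vimage_indicator:
  assumes "V \<subseteq> \<Omega>"
  shows "indicator V -` A \<inter> \<Omega> =
    (if (1 :: 'b :: zero_neq_one) \<in> A then V else {}) \<union> (if 0 \<in> A then \<Omega> - V else {})"
proof (rule Set.set_eqI)
  fix x
  show "x \<in> indicator V -` A \<inter> \<Omega> \<longleftrightarrow>
      x \<in> (if (1 :: 'b) \<in> A then V else {}) \<union> (if 0 \<in> A then \<Omega> - V else {})"
    using assms by (cases "x \<in> V") auto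
qed

context prob_space
begin

lemma integrable_norm_le_one:
  fixes h :: "'a \<Rightarrow> 'b :: {banach, second_countable_topology}"
  assumes "h \<in> borel_measurable M" "\<And>\<omega>. \<omega> \<in> space M \<Longrightarrow> norm (h \<omega>) \<le> 1"
  shows "integrable M h"
  using assms by (intro integrable_const_bound[of _ 1]) auto

lemma integrable_iexp:
  assumes "f \<in> borel_measurable M"
  shows "integrable M (\<lambda>\<omega>. iexp (f \<omega>))"
  using assms by (intro integrable_norm_le_one) (auto intro: measurable_compose)

text \<open>The case \<open>t = 0\<close> says that \<open>h\<close> has mean 0, and
  \<open>h \<ge> -1\<close>, so \<open>1 + h\<close> is a probability density. Under the new measure
  \<open>Z\<close> has the same characteristic function as before, hence the same distribution by
  Levy's uniqueness theorem. Comparing the two probabilities of \<open>B\<close> leaves the integral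
  against \<open>h\<close>.\<close>

lemma real_weight_orthogonal_indicator:
  fixes h Z :: "'a \<Rightarrow> real"
  assumes [measurable]: "h \<in> borel_measurable M" "Z \<in> borel_measurable M" "B \<in> sets borel"
    and bound: "\<And>\<omega>. \<omega> \<in> space M \<Longrightarrow> \<bar>h \<omega>\<bar> \<le> 1"
    and zero: "\<And>t. (\<integral>\<omega>. complex_of_real (h \<omega>) * iexp (t * Z \<omega>) \<partial>M) = 0"
  shows "(\<integral>\<omega>. h \<omega> * indicator B (Z \<omega>) \<partial>M) = 0"
proof -
  have ge: "0 \<le> 1 + h \<omega>" if "\<omega> \<in> space M" for \<omega>
    using bound[OF that] by linarith
  have int_h: "integrable M h"
    by (rule integrable_norm_le_one) (auto simp: bound)
  have "(\<integral>\<omega>. complex_of_real (h \<omega>) \<partial>M) = 0" using zero[of 0] by simp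
  then have h0: "(\<integral>\<omega>. h \<omega> \<partial>M) = 0" by simp
  define D where "D = density M (\<lambda>\<omega>. ennreal (1 + h \<omega>))"
  have "emeasure D (space D) = (\<integral>\<^sup>+\<omega>. ennreal (1 + h \<omega>) \<partial>M)"
    by (auto simp: D_def emeasure_density intro!: nn_integral_cong)
  also have "\<dots> = ennreal (\<integral>\<omega>. 1 + h \<omega> \<partial>M)"
    using int_h ge by (intro nn_integral_eq_integral) auto
  also have "\<dots> = 1" using int_h h0 by (simp add: prob_space)
  finally interpret D: prob_space D by (rule prob_spaceI)
  have [measurable]: "Z \<in> borel_measurable D" by (simp add: D_def)
  have intD: "(\<integral>\<omega>. f \<omega> \<partial>D) = (\<integral>\<omega>. f \<omega> \<partial>M) + (\<integral>\<omega>. h \<omega> *\<^sub>R f \<omega> \<partial>M)"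
    if [measurable]: "f \<in> borel_measurable M" and f: "\<And>\<omega>. norm (f \<omega>) \<le> 1"
    for f :: "'a \<Rightarrow> 'b :: {banach, second_countable_topology}"
  proof -
    have "integrable M f" by (rule integrable_norm_le_one) (auto simp: f)
    moreover have "integrable M (\<lambda>\<omega>. h \<omega> *\<^sub>R f \<omega>)"
      using f bound by (intro integrable_norm_le_one) (auto intro!: mult_le_one)
    moreover have "(\<integral>\<omega>. f \<omega> \<partial>D) = (\<integral>\<omega>. (1 + h \<omega>) *\<^sub>R f \<omega> \<partial>M)"
      unfolding D_def by (rule integral_density) (auto simp: ge)
    ultimately show ?thesis by (simp add: scaleR_add_left)
  qed
  have "char (distr D borel Z) = char (distr M borel Z)"
  proof
    fix t
    show "char (distr D borel Z) t = char (distr M borel Z) t"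
      using zero[of t] by (simp add: char_def integral_distr intD scaleR_conv_of_real)
  qed
  then have eq: "distr D borel Z = distr M borel Z"
    by (intro Levy_uniqueness) (auto intro: D.real_distribution_distr real_distribution_distr)
  have "(\<integral>\<omega>. indicator B (Z \<omega>) \<partial>D) = (\<integral>x. indicator B x \<partial>distr D borel Z :: real)"
    by (rule integral_distr[symmetric]) auto
  also have "\<dots> = (\<integral>\<omega>. indicator B (Z \<omega>) \<partial>M)"
    unfolding eq by (rule integral_distr) auto
  finally show ?thesis
    by (subst (asm) intD) (auto simp: indicator_def)
qed

text \<open>Conjugating the hypothesis at \<open>-t\<close> gives the hypothesis at \<open>t\<close>
  for the conjugate weight. Averaging the two puts the real part of \<open>h\<close> in the place of
  \<open>h\<close>, which is the case of a real weight.\<close>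

lemma Re_weight_orthogonal_indicator:
  fixes h :: "'a \<Rightarrow> complex" and Z :: "'a \<Rightarrow> real"
  assumes [measurable]: "h \<in> borel_measurable M" "Z \<in> borel_measurable M" "B \<in> sets borel"
    and bound: "\<And>\<omega>. \<omega> \<in> space M \<Longrightarrow> norm (h \<omega>) \<le> 1"
    and zero: "\<And>t. (\<integral>\<omega>. h \<omega> * iexp (t * Z \<omega>) \<partial>M) = 0"
  shows "(\<integral>\<omega>. Re (h \<omega>) * indicator B (Z \<omega>) \<partial>M) = 0"
proof (rule real_weight_orthogonal_indicator)
  show "\<bar>Re (h \<omega>)\<bar> \<le> 1" if "\<omega> \<in> space M" for \<omega>
    using abs_Re_le_cmod[of "h \<omega>"] bound[OF that] by linarith
  fix t
  have int: "integrable M (\<lambda>\<omega>. h \<omega> * iexp (t * Z \<omega>))" for t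
    by (rule integrable_norm_le_one) (auto simp: norm_mult bound)
  define f where "f = (\<lambda>t \<omega>. h \<omega> * iexp (t * Z \<omega>))"
  have f: "integrable M (f t)" "integral\<^sup>L M (f t) = 0" for t
    using int[of t] zero[of t] by (simp_all add: f_def)
  have "integrable M (\<lambda>\<omega>. cnj (f (- t) \<omega>))" "(\<integral>\<omega>. cnj (f (- t) \<omega>) \<partial>M) = 0"
    using f[of "- t"] by (auto simp: Bochner_Integration.integral_cnj)
  moreover have "complex_of_real (Re (h \<omega>)) * iexp (t * Z \<omega>) = (f t \<omega> + cnj (f (- t) \<omega>)) / 2" for \<omega>
  proof -
    have "cnj (iexp (- t * Z \<omega>)) = iexp (t * Z \<omega>)" by (simp add: exp_cnj)
    then have "f t \<omega> + cnj (f (- t) \<omega>) = (h \<omega> + cnj (h \<omega>)) * iexp (t * Z \<omega>)"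
      by (simp only: f_def complex_cnj_mult distrib_right)
    then show ?thesis by (simp add: complex_add_cnj)
  qed
  ultimately show "(\<integral>\<omega>. complex_of_real (Re (h \<omega>)) * iexp (t * Z \<omega>) \<partial>M) = 0"
    using f[of t] by (simp only: Bochner_Integration.integral_divide_zero Bochner_Integration.integral_add add_0 div_0)
qed auto

text \<open>The imaginary part of \<open>h\<close> is the real part of \<open>- \<i> * h\<close>,
  and this weight satisfies the same hypotheses.\<close>

lemma complex_weight_orthogonal_indicator:
  fixes h :: "'a \<Rightarrow> complex" and Z :: "'a \<Rightarrow> real"
  assumes [measurable]: "h \<in> borel_measurable M" "Z \<in> borel_measurable M" "B \<in> sets borel"
    and bound: "\<And>\<omega>. \<omega> \<in> space M \<Longrightarrow> norm (h \<omega>) \<le> 1"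
    and zero: "\<And>t. (\<integral>\<omega>. h \<omega> * iexp (t * Z \<omega>) \<partial>M) = 0"
  shows "(\<integral>\<omega>. h \<omega> * complex_of_real (indicator B (Z \<omega>)) \<partial>M) = 0"
proof -
  let ?f = "\<lambda>\<omega>. h \<omega> * complex_of_real (indicator B (Z \<omega>))"
  have int: "integrable M ?f"
    by (rule integrable_norm_le_one) (auto simp: norm_mult bound indicator_def)
  have "Re (integral\<^sup>L M ?f) = (\<integral>\<omega>. Re (h \<omega>) * indicator B (Z \<omega>) \<partial>M)"
    by (subst integral_Re[OF int, symmetric]) simp
  also have "\<dots> = 0"
    by (rule Re_weight_orthogonal_indicator[OF _ _ _ _ zero]) (auto simp: bound)
  finally have "Re (integral\<^sup>L M ?f) = 0" .
  moreover have "Im (integral\<^sup>L M ?f) = (\<integral>\<omega>. Re (- \<i> * h \<omega>) * indicator B (Z \<omega>) \<partial>M)"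
    by (subst integral_Im[OF int, symmetric]) simp
  moreover have "(\<integral>\<omega>. Re (- \<i> * h \<omega>) * indicator B (Z \<omega>) \<partial>M) = 0"
  proof (rule Re_weight_orthogonal_indicator)
    show "(\<integral>\<omega>. - \<i> * h \<omega> * iexp (t * Z \<omega>) \<partial>M) = 0" for t
      using zero[of t] by (simp add: mult.assoc)
  qed (auto simp: bound norm_mult)
  ultimately show ?thesis by (simp add: complex_eq_iff)
qed

text \<open>This is the substitute for a multidimensional uniqueness theorem: the
  coordinates are treated one at a time, and each resulting indicator is absorbed into the weight.\<close>

lemma complex_weight_orthogonal_box:
  fixes h :: "'a \<Rightarrow> complex" and Z :: "nat \<Rightarrow> 'a \<Rightarrow> real"
  assumes "h \<in> borel_measurable M" "\<And>j. j < q \<Longrightarrow> Z j \<in> borel_measurable M"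
    and "\<And>j. j < q \<Longrightarrow> B j \<in> sets borel"
    and "\<And>\<omega>. \<omega> \<in> space M \<Longrightarrow> norm (h \<omega>) \<le> 1"
    and "\<And>t. (\<integral>\<omega>. h \<omega> * iexp (\<Sum>j<q. t j * Z j \<omega>) \<partial>M) = 0"
  shows "(\<integral>\<omega>. h \<omega> * complex_of_real (\<Prod>j<q. indicator (B j) (Z j \<omega>)) \<partial>M) = 0"
  using assms
proof (induction q arbitrary: h)
  case 0
  then show ?case by simp
next
  case (Suc q)
  note [measurable] = Suc.prems(1)
  have Z[measurable]: "\<And>j. j < Suc q \<Longrightarrow> Z j \<in> borel_measurable M" by (rule Suc.prems(2))
  have [measurable]: "Z q \<in> borel_measurable M" "B q \<in> sets borel" using Suc.prems by auto
  have bound: "\<And>\<omega>. \<omega> \<in> space M \<Longrightarrow> norm (h \<omega>) \<le> 1" by (rule Suc.prems(4))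
  have "(\<integral>\<omega>. (h \<omega> * complex_of_real (indicator (B q) (Z q \<omega>))) *
      complex_of_real (\<Prod>j<q. indicator (B j) (Z j \<omega>)) \<partial>M) = 0"
  proof (rule Suc.IH)
    fix t :: "nat \<Rightarrow> real"
    have [measurable]: "(\<lambda>\<omega>. \<Sum>j<q. t j * Z j \<omega>) \<in> borel_measurable M"
      by (intro borel_measurable_sum borel_measurable_times) auto
    \<comment> \<open>The exponential of the first \<open>q\<close> coordinates joins the weight,
      leaving \<open>Z q\<close> as the only variable. The update \<open>t(q := s)\<close> recovers
      the hypothesis on all \<open>Suc q\<close> coordinates.\<close>
    have "(\<integral>\<omega>. (h \<omega> * iexp (\<Sum>j<q. t j * Z j \<omega>)) * complex_of_real (indicator (B q) (Z q \<omega>)) \<partial>M) = 0"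
    proof (rule complex_weight_orthogonal_indicator)
      fix s
      have "iexp (\<Sum>j<q. t j * Z j \<omega>) * iexp (s * Z q \<omega>) =
          iexp (\<Sum>j<Suc q. (t(q := s)) j * Z j \<omega>)" for \<omega>
        by (simp add: exp_add distrib_left)
      then show "(\<integral>\<omega>. h \<omega> * iexp (\<Sum>j<q. t j * Z j \<omega>) * iexp (s * Z q \<omega>) \<partial>M) = 0"
        using Suc.prems(5)[of "t(q := s)"] by (simp only: mult.assoc)
    qed (auto simp: norm_mult bound)
    then show "(\<integral>\<omega>. h \<omega> * complex_of_real (indicator (B q) (Z q \<omega>)) *
        iexp (\<Sum>j<q. t j * Z j \<omega>) \<partial>M) = 0"
      by (simp only: mult_ac)
  qed (use Suc.prems in \<open>auto simp: norm_mult indicator_def\<close>)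
  then show ?case by (simp add: mult_ac)
qed

text \<open>The weight lemmas are used twice: first for fixed \<open>s\<close>, to replace the
  exponentials in \<open>Z\<close> by the indicator of a box, then for that box, to replace the
  exponential in \<open>u\<close> by the indicator of \<open>C\<close>. Boxes generate the product
  \<sigma>-algebra and are stable under intersection, which gives all \<open>E\<close>. Stating
  independence with a real indicator lets expectations of products be factored later.\<close>

lemma indep_var_indicator_char:
  fixes u :: "'a \<Rightarrow> real" and Z :: "nat \<Rightarrow> 'a \<Rightarrow> real"
  assumes u[measurable]: "u \<in> borel_measurable M"
    and Z: "\<And>j. j < q \<Longrightarrow> Z j \<in> borel_measurable M"
    and char: "\<And>s t. (\<integral>\<omega>. iexp (s * u \<omega>) * iexp (\<Sum>j<q. t j * Z j \<omega>) \<partial>M) =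
      (\<integral>\<omega>. iexp (s * u \<omega>) \<partial>M) * (\<integral>\<omega>. iexp (\<Sum>j<q. t j * Z j \<omega>) \<partial>M)"
    and E: "E \<in> sets (\<Pi>\<^sub>M j\<in>{..<q}. borel)"
  shows "indep_var borel u borel
    (indicator ((\<lambda>\<omega>. \<lambda>j\<in>{..<q}. Z j \<omega>) -` E \<inter> space M) :: 'a \<Rightarrow> real)"
proof -
  let ?P = "\<Pi>\<^sub>M j\<in>{..<q}. (borel :: real measure)" and ?Z = "\<lambda>\<omega>. \<lambda>j\<in>{..<q}. Z j \<omega>"
  have Zm[measurable]: "?Z \<in> measurable M ?P"
    using Z by (intro measurable_restrict) auto
  have box: "prob ((u -` C \<inter> space M) \<inter> (?Z -` (\<Pi>\<^sub>E j\<in>{..<q}. B j) \<inter> space M)) =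
      prob (u -` C \<inter> space M) * prob (?Z -` (\<Pi>\<^sub>E j\<in>{..<q}. B j) \<inter> space M)"
    if C[measurable]: "C \<in> sets borel" and B: "\<And>j. j < q \<Longrightarrow> B j \<in> sets borel" for B C
  proof -
    define V where "V = ?Z -` (\<Pi>\<^sub>E j\<in>{..<q}. B j) \<inter> space M"
    have V[measurable]: "V \<in> sets M"
      unfolding V_def using B by (intro measurable_sets[OF Zm] sets_PiM_I_finite) auto
    have ind: "(\<Prod>j<q. indicator (B j) (Z j \<omega>)) = (indicator V \<omega> :: real)"
      if "\<omega> \<in> space M" for \<omega>
    proof (cases "\<forall>j<q. Z j \<omega> \<in> B j")
      case True
      then show ?thesis using that by (auto simp: V_def)
    next
      case False
      then obtain j where "j < q" "Z j \<omega> \<notin> B j" by auto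
      then show ?thesis by (auto simp: V_def indicator_def PiE_iff intro!: prod_zero)
    qed
    have weight: "(\<integral>\<omega>. complex_of_real (indicator V \<omega> - prob V) * iexp (s * u \<omega>) \<partial>M) = 0" for s
    proof -
      define c where "c = (\<integral>\<omega>. iexp (s * u \<omega>) \<partial>M)"
      have int_e: "integrable M (\<lambda>\<omega>. iexp (s * u \<omega>))"
        by (rule integrable_iexp) measurable
      have "norm c \<le> (\<integral>\<omega>. norm (iexp (s * u \<omega>)) \<partial>M)"
        unfolding c_def by (rule integral_norm_bound)
      then have c: "norm c \<le> 1" by (simp add: prob_space)
      \<comment> \<open>Subtracting \<open>c\<close> makes the weight orthogonal to every
        exponential in \<open>Z\<close>; since both terms have norm at most 1, halving keeps the
        weight within the bound.\<close>
      have "(\<integral>\<omega>. (iexp (s * u \<omega>) - c) / 2 *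
          complex_of_real (\<Prod>j<q. indicator (B j) (Z j \<omega>)) \<partial>M) = 0"
      proof (rule complex_weight_orthogonal_box[OF _ Z B])
        show "norm ((iexp (s * u \<omega>) - c) / 2) \<le> 1" for \<omega>
          using c norm_triangle_ineq4[of "iexp (s * u \<omega>)" c] by simp
        fix t :: "nat \<Rightarrow> real"
        have [measurable]: "(\<lambda>\<omega>. \<Sum>j<q. t j * Z j \<omega>) \<in> borel_measurable M"
          using Z by (intro borel_measurable_sum borel_measurable_times) auto
        have "integrable M (\<lambda>\<omega>. iexp (\<Sum>j<q. t j * Z j \<omega>))"
          by (rule integrable_iexp) measurable
        moreover have "integrable M (\<lambda>\<omega>. iexp (s * u \<omega>) * iexp (\<Sum>j<q. t j * Z j \<omega>))"
        proof (rule integrable_norm_le_one)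
          show "(\<lambda>\<omega>. iexp (s * u \<omega>) * iexp (\<Sum>j<q. t j * Z j \<omega>)) \<in> borel_measurable M"
            by measurable
        qed (simp add: norm_mult)
        ultimately have "(\<integral>\<omega>. iexp (s * u \<omega>) * iexp (\<Sum>j<q. t j * Z j \<omega>) -
            c * iexp (\<Sum>j<q. t j * Z j \<omega>) \<partial>M) = 0"
          using char[of s t] by (simp add: c_def)
        then show "(\<integral>\<omega>. (iexp (s * u \<omega>) - c) / 2 * iexp (\<Sum>j<q. t j * Z j \<omega>) \<partial>M) = 0"
          by (simp add: left_diff_distrib)
      qed auto
      also have "(\<integral>\<omega>. (iexp (s * u \<omega>) - c) / 2 *
            complex_of_real (\<Prod>j<q. indicator (B j) (Z j \<omega>)) \<partial>M) =
          (\<integral>\<omega>. (iexp (s * u \<omega>) - c) / 2 * complex_of_real (indicator V \<omega>) \<partial>M)"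
        by (intro Bochner_Integration.integral_cong) (auto simp: ind simp del: of_real_prod)
      finally have "(\<integral>\<omega>. iexp (s * u \<omega>) * complex_of_real (indicator V \<omega>) -
          c * complex_of_real (indicator V \<omega>) \<partial>M) = 0"
        by (simp add: left_diff_distrib)
      moreover have int_V: "integrable M (\<lambda>\<omega>. complex_of_real (indicator V \<omega>))"
        by (rule integrable_norm_le_one) (auto simp: indicator_def)
      moreover have int_eV: "integrable M (\<lambda>\<omega>. iexp (s * u \<omega>) * complex_of_real (indicator V \<omega>))"
        by (rule integrable_norm_le_one) (auto simp: indicator_def norm_mult)
      ultimately have "(\<integral>\<omega>. iexp (s * u \<omega>) * complex_of_real (indicator V \<omega>) \<partial>M) =
          c * complex_of_real (prob V)"
        by simp
      then have "(\<integral>\<omega>. iexp (s * u \<omega>) * complex_of_real (indicator V \<omega>) -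
          complex_of_real (prob V) * iexp (s * u \<omega>) \<partial>M) = 0"
        using int_e int_eV by (simp add: c_def)
      then show ?thesis by (simp add: algebra_simps)
    qed
    \<comment> \<open>Second pass: the centred indicator of the box is now the weight, and
      \<open>u\<close> is the variable.\<close>
    have "(\<integral>\<omega>. (indicator V \<omega> - prob V) * indicator C (u \<omega>) \<partial>M) = 0"
    proof (rule real_weight_orthogonal_indicator[OF _ _ _ _ weight])
      show "\<bar>indicator V \<omega> - prob V\<bar> \<le> 1" for \<omega>
        using prob_le_1[of V] measure_nonneg[of M V] by (auto simp: indicator_def)
    qed auto
    moreover have "(\<integral>\<omega>. (indicator V \<omega> - prob V) * indicator C (u \<omega>) \<partial>M) =
        (\<integral>\<omega>. indicator ((u -` C \<inter> space M) \<inter> V) \<omega> - prob V * indicator (u -` C \<inter> space M) \<omega> \<partial>M)"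
      by (intro Bochner_Integration.integral_cong) (auto simp: indicator_def)
    moreover have UC: "u -` C \<inter> space M \<in> events" by measurable
    moreover have "(u -` C \<inter> space M) \<inter> V \<in> events" using UC V by (rule sets.Int)
    then have "integrable M (indicator ((u -` C \<inter> space M) \<inter> V) :: 'a \<Rightarrow> real)"
      by (simp add: less_top[symmetric])
    moreover have "integrable M (indicator (u -` C \<inter> space M) :: 'a \<Rightarrow> real)"
      using UC by (simp add: less_top[symmetric])
    moreover have "((u -` C \<inter> space M) \<inter> V) \<inter> space M = (u -` C \<inter> space M) \<inter> V" by auto
    ultimately show ?thesis
      unfolding V_def[symmetric] by (simp add: mult.commute)
  qed
  \<comment> \<open>The passage from boxes to arbitrary \<open>E\<close> goes through
    intersection-stable generators of the two \<sigma>-algebras.\<close>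
  let ?A = "{u -` A \<inter> space M | A. A \<in> sets borel}"
  let ?B = "{?Z -` A \<inter> space M | A. A \<in> prod_algebra {..<q} (\<lambda>_. borel :: real measure)}"
  have "indep_set (sigma_sets (space M) ?A) (sigma_sets (space M) ?B)"
  proof (rule indep_set_sigma_sets)
    show "indep_set ?A ?B"
    proof (rule indep_setI)
      show "?A \<subseteq> events" by auto
      show "?B \<subseteq> events"
        by (auto intro!: measurable_sets[OF Zm] simp: sets_PiM)
      fix a b assume "a \<in> ?A" "b \<in> ?B"
      then obtain C and B :: "nat \<Rightarrow> real set" where
        "a = u -` C \<inter> space M" "C \<in> sets borel"
        "b = ?Z -` (\<Pi>\<^sub>E j\<in>{..<q}. B j) \<inter> space M" "\<And>j. j < q \<Longrightarrow> B j \<in> sets borel"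
        by (force simp: prod_algebra_eq_finite)
      then show "prob (a \<inter> b) = prob a * prob b"
        by (simp only: box)
    qed
    show "Int_stable ?A"
    proof (rule Int_stableI)
      fix a b assume "a \<in> ?A" "b \<in> ?A"
      then obtain A B where "a = u -` A \<inter> space M" "b = u -` B \<inter> space M"
        "A \<in> sets borel" "B \<in> sets borel" by auto
      then show "a \<inter> b \<in> ?A" by (auto intro!: exI[of _ "A \<inter> B"])
    qed
    show "Int_stable ?B"
    proof (rule Int_stableI)
      fix a b assume "a \<in> ?B" "b \<in> ?B"
      then obtain A B where "a = ?Z -` A \<inter> space M" "b = ?Z -` B \<inter> space M"
        "A \<in> prod_algebra {..<q} (\<lambda>_. borel :: real measure)"
        "B \<in> prod_algebra {..<q} (\<lambda>_. borel :: real measure)" by auto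
      then show "a \<inter> b \<in> ?B"
        by (intro CollectI exI[of _ "A \<inter> B"] conjI Int_stableD[OF Int_stable_prod_algebra]) auto
    qed
  qed
  note indep = this
  let ?V = "?Z -` E \<inter> space M"
  have V: "?V \<in> sigma_sets (space M) ?B"
  proof -
    have "?Z \<in> space M \<rightarrow> (\<Pi>\<^sub>E j\<in>{..<q}. space borel)" by auto
    from sigma_sets_vimage_commute[OF this, of "prod_algebra {..<q} (\<lambda>_. borel :: real measure)"] E
    show ?thesis by (auto simp: sets_PiM)
  qed
  let ?C = "{indicator ?V -` A \<inter> space M | A. A \<in> sets (borel :: real measure)}"
  have "sigma_sets (space M) ?C \<subseteq> sigma_sets (space M) ?B"
  proof (rule sigma_sets_mono, rule subsetI)
    fix a assume "a \<in> ?C"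
    then obtain A :: "real set" where "a = indicator ?V -` A \<inter> space M" by auto
    then have "a = (if 1 \<in> A then ?V else {}) \<union> (if 0 \<in> A then space M - ?V else {})"
      by (simp only: vimage_indicator[of ?V "space M"] Int_lower2)
    moreover have "space M - ?V \<in> sigma_sets (space M) ?B" using V by (rule sigma_sets.Compl)
    ultimately show "a \<in> sigma_sets (space M) ?B"
      using V by (auto intro!: sigma_sets_Un sigma_sets.Empty sigma_sets_top)
  qed
  then have "indep_set (sigma_sets (space M) ?A) (sigma_sets (space M) ?C)"
    using indep_setD[OF indep] indep_setD_ev1[OF indep] indep_setD_ev2[OF indep]
    by (intro indep_setI) auto
  then show ?thesis
    using measurable_sets[OF Zm E] unfolding indep_var_eq by auto
qed

end

section \<open>Gaussian vectors\<close>

context prob_space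
begin

lemma gaussian_rv_cases:
  assumes "gaussian_rv M X"
  obtains (normal) \<mu> s where "0 < s" "distributed M lborel X (normal_density \<mu> s)"
  | (const) c where "AE \<omega> in M. X \<omega> = c"
  using assms by (auto simp: gaussian_rv_def)

lemma gaussian_rv_measurable: "gaussian_rv M X \<Longrightarrow> X \<in> borel_measurable M"
  by (simp add: gaussian_rv_def)

lemma gaussian_rv_integrable:
  assumes X: "gaussian_rv M X"
  shows "integrable M X" "integrable M (\<lambda>\<omega>. (X \<omega>)\<^sup>2)"
proof -
  note [measurable] = gaussian_rv_measurable[OF X]
  have "integrable M X \<and> integrable M (\<lambda>\<omega>. (X \<omega>)\<^sup>2)"
    using X
  proof (cases rule: gaussian_rv_cases)
    case (normal \<mu> s)
    have *: "integrable M (\<lambda>\<omega>. (X \<omega> - \<mu>) ^ k)" for k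
      using integrable_normal_moment[OF normal(1), of \<mu> k] normal
      by (subst distributed_integrable[OF normal(2), symmetric]) auto
    \<comment> \<open>The central moments of the normal law are integrable; the raw ones follow by
      shifting by \<open>\<mu>\<close>.\<close>
    have "integrable M (\<lambda>\<omega>. (X \<omega> - \<mu>) ^ 1 + \<mu>)"
      by (intro Bochner_Integration.integrable_add *) auto
    then have X1: "integrable M X" by simp
    have "integrable M (\<lambda>\<omega>. (X \<omega> - \<mu>) ^ 2 + (2 * \<mu> * X \<omega> - \<mu>\<^sup>2))"
      using X1 by (intro Bochner_Integration.integrable_add *) auto
    then show ?thesis using X1 by (simp add: power2_eq_square algebra_simps)
  next
    case (const c)
    then have "AE \<omega> in M. X \<omega> = (\<lambda>_. c) \<omega>" "AE \<omega> in M. (X \<omega>)\<^sup>2 = (\<lambda>_. c\<^sup>2) \<omega>" by auto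
    then show ?thesis
      using integrable_cong_AE[of X M "\<lambda>_. c"] integrable_cong_AE[of "\<lambda>\<omega>. (X \<omega>)\<^sup>2" M "\<lambda>_. c\<^sup>2"]
      by auto
  qed
  then show "integrable M X" "integrable M (\<lambda>\<omega>. (X \<omega>)\<^sup>2)" by auto
qed

text \<open>For a centred normal variable with deviation \<open>s\<close>, the value is that of the
  standard normal characteristic function of \<open>X / s\<close> at \<open>s\<close>. A point mass
  with mean 0 sits at 0, and both sides are 1.\<close>

lemma gaussian_rv_char:
  assumes X: "gaussian_rv M X" and mean: "expectation X = 0"
  shows "(\<integral>\<omega>. iexp (X \<omega>) \<partial>M) = complex_of_real (exp (- expectation (\<lambda>\<omega>. (X \<omega>)\<^sup>2) / 2))"
proof -
  note [measurable] = gaussian_rv_measurable[OF X]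
  show ?thesis
    using X
  proof (cases rule: gaussian_rv_cases)
    case (normal \<mu> s)
    have \<mu>: "\<mu> = 0" using normal_distributed_expectation[OF normal] mean by simp
    have var: "expectation (\<lambda>\<omega>. (X \<omega>)\<^sup>2) = s\<^sup>2"
      using normal_distributed_variance[OF normal] mean by simp
    have "distributed M lborel (\<lambda>\<omega>. X \<omega> / s) std_normal_density"
      using normal normal_standard_normal_convert[OF normal(1), of X \<mu>] by (simp add: \<mu>)
    then have "distr M lborel (\<lambda>\<omega>. X \<omega> / s) = std_normal_distribution"
      by (rule distributed_distr_eq_density)
    \<comment> \<open>The density statement lives on \<open>lborel\<close>, \<open>char\<close> on
      \<open>borel\<close>; the two have the same measurable sets.\<close>
    moreover have "distr M lborel (\<lambda>\<omega>. X \<omega> / s) = distr M borel (\<lambda>\<omega>. X \<omega> / s)"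
      by (rule distr_cong) auto
    ultimately have "char (distr M borel (\<lambda>\<omega>. X \<omega> / s)) s = complex_of_real (exp (- (s\<^sup>2) / 2))"
      by (simp add: char_std_normal_distribution)
    moreover have "char (distr M borel (\<lambda>\<omega>. X \<omega> / s)) s = (\<integral>\<omega>. iexp (s * (X \<omega> / s)) \<partial>M)"
      unfolding char_def by (rule integral_distr) auto
    moreover have "s * (X \<omega> / s) = X \<omega>" for \<omega> using normal(1) by simp
    ultimately show ?thesis using var by simp
  next
    case (const c)
    have "expectation X = expectation (\<lambda>_. c)"
      by (rule integral_cong_AE) (use const in auto)
    then have "c = 0" using mean by (simp add: prob_space)
    then have X0: "AE \<omega> in M. X \<omega> = 0" using const by simp
    have "(\<integral>\<omega>. iexp (X \<omega>) \<partial>M) = (\<integral>\<omega>. 1 \<partial>M)"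
      by (rule integral_cong_AE) (use X0 in auto)
    moreover have "expectation (\<lambda>\<omega>. (X \<omega>)\<^sup>2) = expectation (\<lambda>_. 0)"
      by (rule integral_cong_AE) (use X0 in auto)
    ultimately show ?thesis by (simp add: prob_space)
  qed
qed

end

section \<open>Linear forms in white noise\<close>

locale white_noise = prob_space M for M :: "'a measure" +
  fixes I :: "'i set" and \<eta> :: "'i \<Rightarrow> 'a \<Rightarrow> real" and \<sigma> :: real
  assumes fin: "finite I"
    and gaussian: "jointly_gaussian M I \<eta>"
    and mean_zero: "\<And>a. a \<in> I \<Longrightarrow> expectation (\<eta> a) = 0"
    and white: "\<And>a b. a \<in> I \<Longrightarrow> b \<in> I \<Longrightarrow>
      expectation (\<lambda>\<omega>. \<eta> a \<omega> * \<eta> b \<omega>) = (if a = b then \<sigma>\<^sup>2 else 0)"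
begin

text \<open>A linear form in the noise is represented by its coefficient function. Covariances then
  become \<open>\<sigma>\<^sup>2\<close> times the inner product \<open>ip\<close> of coefficients,
  and uncorrelated means orthogonal.\<close>

definition comb :: "('i \<Rightarrow> real) \<Rightarrow> 'a \<Rightarrow> real" where
  "comb c \<omega> = (\<Sum>a\<in>I. c a * \<eta> a \<omega>)"

definition ip :: "('i \<Rightarrow> real) \<Rightarrow> ('i \<Rightarrow> real) \<Rightarrow> real" where
  "ip c d = (\<Sum>a\<in>I. c a * d a)"

lemma ip_commute: "ip c d = ip d c"
  by (simp add: ip_def mult.commute)

lemma ip_add_left: "ip (\<lambda>a. c a + d a) e = ip c e + ip d e"
  by (simp add: ip_def distrib_right sum.distrib)

lemma ip_diff_left: "ip (\<lambda>a. c a - d a) e = ip c e - ip d e"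
  by (simp add: ip_def left_diff_distrib sum_subtractf)

lemma ip_scale_left: "ip (\<lambda>a. s * c a) e = s * ip c e"
  by (simp add: ip_def sum_distrib_left mult.assoc)

lemma ip_sum_left: "ip (\<lambda>a. \<Sum>j\<in>J. c j a) e = (\<Sum>j\<in>J. ip (c j) e)"
  unfolding ip_def sum_distrib_right by (rule sum.swap)

lemma comb_add: "comb (\<lambda>a. c a + d a) \<omega> = comb c \<omega> + comb d \<omega>"
  by (simp add: comb_def distrib_right sum.distrib)

lemma comb_diff: "comb (\<lambda>a. c a - d a) \<omega> = comb c \<omega> - comb d \<omega>"
  by (simp add: comb_def left_diff_distrib sum_subtractf)

lemma comb_scale: "comb (\<lambda>a. s * c a) \<omega> = s * comb c \<omega>"
  by (simp add: comb_def sum_distrib_left mult.assoc)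

lemma comb_sum: "comb (\<lambda>a. \<Sum>j\<in>J. c j a) \<omega> = (\<Sum>j\<in>J. comb (c j) \<omega>)"
  unfolding comb_def sum_distrib_right by (rule sum.swap)

lemma comb_unit:
  assumes "a \<in> I"
  shows "comb (\<lambda>b. if b = a then 1 else 0) \<omega> = \<eta> a \<omega>"
proof -
  have "comb (\<lambda>b. if b = a then 1 else 0) \<omega> = (\<Sum>b\<in>I. if b = a then \<eta> b \<omega> else 0)"
    unfolding comb_def by (rule sum.cong) auto
  then show ?thesis using fin assms by simp
qed

lemma gaussian_comb: "gaussian_rv M (comb c)"
  using gaussian unfolding jointly_gaussian_def comb_def[abs_def] by blast

lemma comb_measurable[measurable]: "comb c \<in> borel_measurable M"
  by (rule gaussian_rv_measurable[OF gaussian_comb])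

lemma integrable_comb: "integrable M (comb c)"
  by (rule gaussian_rv_integrable[OF gaussian_comb])

text \<open>Polarization: the product is a quarter of a difference of squares of two linear forms,
  each Gaussian with a second moment.\<close>

lemma integrable_comb_mult: "integrable M (\<lambda>\<omega>. comb c \<omega> * comb d \<omega>)"
proof -
  have "integrable M (\<lambda>\<omega>. ((comb (\<lambda>a. c a + d a) \<omega>)\<^sup>2 - (comb (\<lambda>a. c a - d a) \<omega>)\<^sup>2) / 4)"
    by (intro integrable_divide Bochner_Integration.integrable_diff
        gaussian_rv_integrable(2)[OF gaussian_comb])
  then show ?thesis
    by (simp add: comb_add comb_diff power2_eq_square algebra_simps)
qed

lemma integrable_noise: "a \<in> I \<Longrightarrow> integrable M (\<eta> a)"
  using integrable_comb[of "\<lambda>b. if b = a then 1 else 0"]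
  by (simp add: comb_unit cong: Bochner_Integration.integrable_cong)

lemma integrable_noise_mult: "a \<in> I \<Longrightarrow> b \<in> I \<Longrightarrow> integrable M (\<lambda>\<omega>. \<eta> a \<omega> * \<eta> b \<omega>)"
  using integrable_comb_mult[of "\<lambda>k. if k = a then 1 else 0" "\<lambda>k. if k = b then 1 else 0"]
  by (simp add: comb_unit)

lemma expectation_comb: "expectation (comb c) = 0"
proof -
  have "expectation (comb c) = (\<Sum>a\<in>I. expectation (\<lambda>\<omega>. c a * \<eta> a \<omega>))"
    unfolding comb_def[abs_def] by (rule Bochner_Integration.integral_sum) (simp add: integrable_noise)
  then show ?thesis by (simp add: mean_zero)
qed

lemma expectation_comb_mult: "expectation (\<lambda>\<omega>. comb c \<omega> * comb d \<omega>) = \<sigma>\<^sup>2 * ip c d"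
proof -
  have "expectation (\<lambda>\<omega>. comb c \<omega> * comb d \<omega>) =
      expectation (\<lambda>\<omega>. \<Sum>a\<in>I. \<Sum>b\<in>I. c a * d b * (\<eta> a \<omega> * \<eta> b \<omega>))"
    by (simp add: comb_def sum_product mult_ac)
  also have "\<dots> = (\<Sum>a\<in>I. \<Sum>b\<in>I. c a * d b * expectation (\<lambda>\<omega>. \<eta> a \<omega> * \<eta> b \<omega>))"
    by (simp add: Bochner_Integration.integral_sum integrable_noise_mult)
  also have "\<dots> = (\<Sum>a\<in>I. \<Sum>b\<in>I. if b = a then \<sigma>\<^sup>2 * (c a * d a) else 0)"
    by (intro sum.cong) (auto simp: white)
  also have "\<dots> = \<sigma>\<^sup>2 * ip c d"
    using fin by (simp add: ip_def sum_distrib_left)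
  finally show ?thesis .
qed

lemma char_comb: "(\<integral>\<omega>. iexp (comb c \<omega>) \<partial>M) = complex_of_real (exp (- (\<sigma>\<^sup>2 * ip c c) / 2))"
  using gaussian_rv_char[OF gaussian_comb[of c] expectation_comb]
  by (simp add: power2_eq_square[of "comb c _"] expectation_comb_mult)

text \<open>By orthogonality the cross terms vanish, \<open>ip\<close> of the sum
  \<open>g + f\<close> with itself is \<open>ip g g + ip f f\<close>, and the Gaussian
  characteristic function of the sum is a product.\<close>

lemma indep_var_comb_indicator:
  fixes q :: nat
  assumes orth: "\<And>j. j < q \<Longrightarrow> ip c (d j) = 0"
    and E: "E \<in> sets (\<Pi>\<^sub>M j\<in>{..<q}. borel)"
  shows "indep_var borel (comb c) borel
    (indicator ((\<lambda>\<omega>. \<lambda>j\<in>{..<q}. comb (d j) \<omega>) -` E \<inter> space M) :: 'a \<Rightarrow> real)"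
proof (rule indep_var_indicator_char[OF _ _ _ E])
  fix s :: real and t :: "nat \<Rightarrow> real"
  define f where "f a = (\<Sum>j<q. t j * d j a)" for a
  define g where "g a = s * c a" for a
  have "ip f g = (\<Sum>j<q. t j * (s * ip (d j) c))"
    unfolding f_def g_def by (simp add: ip_sum_left ip_scale_left ip_commute[of _ "\<lambda>a. s * c a"] ip_commute[of c])
  also have "\<dots> = 0" using orth by (simp add: ip_commute[of _ c])
  finally have fg: "ip f g = 0" .
  have "ip (\<lambda>a. g a + f a) (\<lambda>a. g a + f a) = ip g g + ip f f"
    using fg by (simp add: ip_add_left ip_commute[of _ "\<lambda>a. g a + f a"] ip_commute[of g f])
  then have "(\<integral>\<omega>. iexp (comb (\<lambda>a. g a + f a) \<omega>) \<partial>M) =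
      (\<integral>\<omega>. iexp (comb g \<omega>) \<partial>M) * (\<integral>\<omega>. iexp (comb f \<omega>) \<partial>M)"
    by (simp only: char_comb of_real_mult[symmetric] exp_add[symmetric])
      (simp add: distrib_left add_divide_distrib diff_divide_distrib)
  moreover have "comb g \<omega> = s * comb c \<omega>" "comb f \<omega> = (\<Sum>j<q. t j * comb (d j) \<omega>)" for \<omega>
    by (simp_all add: g_def[abs_def] f_def[abs_def] comb_scale comb_sum)
  ultimately show "(\<integral>\<omega>. iexp (s * comb c \<omega>) * iexp (\<Sum>j<q. t j * comb (d j) \<omega>) \<partial>M) =
      (\<integral>\<omega>. iexp (s * comb c \<omega>) \<partial>M) * (\<integral>\<omega>. iexp (\<Sum>j<q. t j * comb (d j) \<omega>) \<partial>M)"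
    by (simp only: comb_add of_real_add distrib_left exp_add)
qed auto

end

section \<open>Conditioning on linear forms in the noise\<close>

locale white_noise_observed = white_noise M I \<eta> \<sigma>
  for M :: "'a measure" and I :: "'i set" and \<eta> \<sigma> +
  fixes q :: nat and d :: "nat \<Rightarrow> 'i \<Rightarrow> real" and Z :: "'a \<Rightarrow> real vec"
  assumes Z_eq: "\<And>\<omega> j. \<omega> \<in> space M \<Longrightarrow> j < q \<Longrightarrow> Z \<omega> $ j = comb (d j) \<omega>"
begin

definition F :: "'a measure" where
  "F = generated_algebra M q Z"

text \<open>The generated \<sigma>-algebra depends only on the values of the map on the sample
  space, where the entries of \<open>Z\<close> are the forms \<open>comb (d j)\<close>.\<close>

lemma F_eq: "F = vimage_algebra (space M) (\<lambda>\<omega>. \<lambda>j\<in>{..<q}. comb (d j) \<omega>) (\<Pi>\<^sub>M j\<in>{..<q}. borel)"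
  unfolding F_def generated_algebra_def
  by (rule vimage_algebra_cong) (auto simp: Z_eq)

lemma coordinates_measurable:
  "(\<lambda>\<omega>. \<lambda>j\<in>{..<q}. comb (d j) \<omega>) \<in> measurable M (\<Pi>\<^sub>M j\<in>{..<q}. borel)"
  by (intro measurable_restrict) auto

lemma sets_F: "sets F = {(\<lambda>\<omega>. \<lambda>j\<in>{..<q}. comb (d j) \<omega>) -` E \<inter> space M | E. E \<in> sets (\<Pi>\<^sub>M j\<in>{..<q}. borel)}"
  unfolding F_eq by (rule sets_vimage_algebra2) (auto simp: space_PiM)

lemma subalgebra_F: "subalgebra M F"
  unfolding subalgebra_def using measurable_sets[OF coordinates_measurable]
  by (auto simp: sets_F) (simp_all add: F_eq)

sublocale finite_measure_subalgebra M F
  by unfold_locales (rule subalgebra_F)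

lemma observed_measurable:
  assumes "j < q"
  shows "comb (d j) \<in> borel_measurable F"
proof -
  have "(\<lambda>\<omega>. \<lambda>j\<in>{..<q}. comb (d j) \<omega>) \<in> measurable F (\<Pi>\<^sub>M j\<in>{..<q}. borel)"
    unfolding F_eq by (rule measurable_vimage_algebra1) (auto simp: space_PiM)
  then have "(\<lambda>\<omega>. (\<lambda>j\<in>{..<q}. comb (d j) \<omega>) j) \<in> borel_measurable F"
    by (rule measurable_compose[OF _ measurable_component_singleton]) (use assms in auto)
  then show ?thesis using assms by simp
qed

text \<open>Every event of \<open>F\<close> is a preimage under the observed forms, so its indicator
  is independent of \<open>comb c\<close> and the expectation factors. The function \<open>g\<close>
  will be the identity and the square.\<close>

lemma set_integral_orthogonal:
  fixes g :: "real \<Rightarrow> real"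
  assumes orth: "\<And>j. j < q \<Longrightarrow> ip c (d j) = 0" and A: "A \<in> sets F"
    and g[measurable]: "g \<in> borel_measurable borel" and int: "integrable M (\<lambda>\<omega>. g (comb c \<omega>))"
  shows "(\<integral>\<omega>. indicator A \<omega> * g (comb c \<omega>) \<partial>M) = prob A * expectation (\<lambda>\<omega>. g (comb c \<omega>))"
proof -
  have "indep_var borel (comb c) borel (indicator A :: 'a \<Rightarrow> real)"
    using A orth indep_var_comb_indicator[of q c d] by (auto simp: sets_F)
  then have "indep_var borel (g \<circ> comb c) borel ((\<lambda>x. x) \<circ> (indicator A :: 'a \<Rightarrow> real))"
    by (rule indep_var_compose) auto
  moreover have AM: "A \<in> events" using A subalgebra_F by (auto simp: subalgebra_def)
  ultimately have "expectation (\<lambda>\<omega>. (g \<circ> comb c) \<omega> * ((\<lambda>x. x) \<circ> indicator A) \<omega>) =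
      expectation (g \<circ> comb c) * expectation ((\<lambda>x. x) \<circ> indicator A)"
    using int by (intro indep_var_lebesgue_integral) (auto simp: comp_def less_top[symmetric])
  then show ?thesis using AM sets.sets_into_space[OF AM] by (simp add: comp_def mult.commute Int_absorb2)
qed

lemma cond_exp_comb_orthogonal:
  assumes orth: "\<And>j. j < q \<Longrightarrow> ip c (d j) = 0"
  shows "AE \<omega> in M. real_cond_exp M F (comb c) \<omega> = 0"
proof (rule real_cond_exp_charact)
  fix A assume "A \<in> sets F"
  from set_integral_orthogonal[OF orth this, of "\<lambda>x. x"]
  show "(\<integral>x\<in>A. comb c x \<partial>M) = (\<integral>x\<in>A. 0 \<partial>M)"
    by (simp add: set_lebesgue_integral_def integrable_comb expectation_comb)
qed (auto simp: integrable_comb)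

text \<open>Polarization again: \<open>c + e\<close> and \<open>c - e\<close> are orthogonal to all
  \<open>d j\<close>, so independence of single forms suffices, without a joint statement about the
  pair.\<close>

lemma cond_exp_comb_mult_orthogonal:
  assumes c: "\<And>j. j < q \<Longrightarrow> ip c (d j) = 0" and e: "\<And>j. j < q \<Longrightarrow> ip e (d j) = 0"
  shows "AE \<omega> in M. real_cond_exp M F (\<lambda>\<omega>. comb c \<omega> * comb e \<omega>) \<omega> = \<sigma>\<^sup>2 * ip c e"
proof (rule real_cond_exp_charact)
  fix A assume A: "A \<in> sets F"
  then have AM[measurable]: "A \<in> events" using subalgebra_F by (auto simp: subalgebra_def)
  let ?p = "\<lambda>a. c a + e a" and ?m = "\<lambda>a. c a - e a"
  have sq: "(\<integral>\<omega>. indicator A \<omega> * (comb f \<omega>)\<^sup>2 \<partial>M) = prob A * (\<sigma>\<^sup>2 * ip f f)"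
    if "\<And>j. j < q \<Longrightarrow> ip f (d j) = 0" for f
    using set_integral_orthogonal[OF that A, of "\<lambda>x. x\<^sup>2"]
    by (simp add: integrable_comb_mult power2_eq_square expectation_comb_mult)
  have int: "integrable M (\<lambda>\<omega>. indicator A \<omega> * (comb f \<omega>)\<^sup>2)" for f
    using integrable_real_mult_indicator[OF AM gaussian_rv_integrable(2)[OF gaussian_comb[of f]]]
    by (simp add: mult.commute)
  have "(\<integral>\<omega>. indicator A \<omega> * (comb c \<omega> * comb e \<omega>) \<partial>M) =
      (\<integral>\<omega>. (indicator A \<omega> * (comb ?p \<omega>)\<^sup>2 - indicator A \<omega> * (comb ?m \<omega>)\<^sup>2) / 4 \<partial>M)"
    by (rule arg_cong[of _ _ "integral\<^sup>L M"])
      (auto simp: comb_add comb_diff power2_eq_square algebra_simps)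
  also have "\<dots> = (prob A * (\<sigma>\<^sup>2 * ip ?p ?p) - prob A * (\<sigma>\<^sup>2 * ip ?m ?m)) / 4"
    using int by (simp add: sq ip_add_left ip_diff_left c e)
  also have "\<dots> = prob A * (\<sigma>\<^sup>2 * ip c e)"
    by (simp add: ip_add_left ip_diff_left ip_commute[of _ ?p] ip_commute[of _ ?m] ip_commute[of e c]
        algebra_simps)
  also have "\<dots> = (\<integral>\<omega>. indicator A \<omega> * (\<sigma>\<^sup>2 * ip c e) \<partial>M)"
    using sets.sets_into_space[OF AM] by (simp add: Int_absorb2)
  finally show "(\<integral>\<omega>\<in>A. comb c \<omega> * comb e \<omega> \<partial>M) = (\<integral>\<omega>\<in>A. \<sigma>\<^sup>2 * ip c e \<partial>M)"
    by (simp add: set_lebesgue_integral_def)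
qed (auto simp: integrable_comb_mult)

text \<open>The sum over \<open>j\<close> is \<open>F\<close>-measurable and
  \<open>comb (r i)\<close> has conditional expectation 0, so the centred entry is
  \<open>comb (r i)\<close> almost everywhere, and products of these have constant conditional
  expectation.\<close>

theorem cond_cov_orthogonal_residual:
  assumes X: "\<And>\<omega> i. \<omega> \<in> space M \<Longrightarrow> i < p \<Longrightarrow>
      X \<omega> $ i = comb (r i) \<omega> + (\<Sum>j<q. k i j * comb (d j) \<omega>)"
    and orth: "\<And>i j. i < p \<Longrightarrow> j < q \<Longrightarrow> ip (r i) (d j) = 0"
  shows "AE \<omega> in M. cond_cov M p X q Z \<omega> = mat p p (\<lambda>(i, j). \<sigma>\<^sup>2 * ip (r i) (r j))"
proof -
  define D where "D i \<omega> = X \<omega> $ i - real_cond_exp M F (\<lambda>\<omega>. X \<omega> $ i) \<omega>" for i \<omega>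
  define h where "h i \<omega> = (\<Sum>j<q. k i j * comb (d j) \<omega>)" for i \<omega>
  have hF: "h i \<in> borel_measurable F" for i
    unfolding h_def using observed_measurable by (intro borel_measurable_sum borel_measurable_times) auto
  have hint: "integrable M (h i)" for i
    unfolding h_def by (intro Bochner_Integration.integrable_sum) (auto simp: integrable_comb)
  have [measurable]: "h i \<in> borel_measurable M" for i using hint by auto
  have Xm: "(\<lambda>\<omega>. X \<omega> $ i) \<in> borel_measurable M" if "i < p" for i
  proof -
    have "(\<lambda>\<omega>. comb (r i) \<omega> + h i \<omega>) \<in> borel_measurable M" by measurable
    then show ?thesis
      using X that by (subst measurable_cong[where g = "\<lambda>\<omega>. comb (r i) \<omega> + h i \<omega>"]) (auto simp: h_def)
  qed
  have D: "AE \<omega> in M. D i \<omega> = comb (r i) \<omega>" if i: "i < p" for i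
  proof -
    have "AE \<omega> in M. real_cond_exp M F (\<lambda>\<omega>. X \<omega> $ i) \<omega> = real_cond_exp M F (\<lambda>\<omega>. comb (r i) \<omega> + h i \<omega>) \<omega>"
      using X i Xm by (intro real_cond_exp_cong AE_I2) (auto simp: h_def)
    moreover have "AE \<omega> in M. real_cond_exp M F (\<lambda>\<omega>. comb (r i) \<omega> + h i \<omega>) \<omega> =
        real_cond_exp M F (comb (r i)) \<omega> + real_cond_exp M F (h i) \<omega>"
      by (intro real_cond_exp_add integrable_comb hint)
    moreover have "AE \<omega> in M. real_cond_exp M F (comb (r i)) \<omega> = 0"
      using orth[OF i] by (rule cond_exp_comb_orthogonal)
    moreover have "AE \<omega> in M. real_cond_exp M F (h i) \<omega> = h i \<omega>"
      using hint hF by (rule real_cond_exp_F_meas)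
    moreover have "AE \<omega> in M. X \<omega> $ i = comb (r i) \<omega> + h i \<omega>"
      using X i by (intro AE_I2) (simp add: h_def)
    ultimately show ?thesis unfolding D_def by eventually_elim simp
  qed
  have Dm: "D i \<in> borel_measurable M" if "i < p" for i
    unfolding D_def using Xm[OF that] by measurable
  have "AE \<omega> in M. real_cond_exp M F (\<lambda>\<omega>. D i \<omega> * D j \<omega>) \<omega> = \<sigma>\<^sup>2 * ip (r i) (r j)"
    if ij: "i < p" "j < p" for i j
  proof -
    have "AE \<omega> in M. D i \<omega> * D j \<omega> = comb (r i) \<omega> * comb (r j) \<omega>"
      using D[OF ij(1)] D[OF ij(2)] by eventually_elim simp
    then have "AE \<omega> in M. real_cond_exp M F (\<lambda>\<omega>. D i \<omega> * D j \<omega>) \<omega> =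
        real_cond_exp M F (\<lambda>\<omega>. comb (r i) \<omega> * comb (r j) \<omega>) \<omega>"
      using Dm ij by (intro real_cond_exp_cong) auto
    moreover have "AE \<omega> in M. real_cond_exp M F (\<lambda>\<omega>. comb (r i) \<omega> * comb (r j) \<omega>) \<omega> = \<sigma>\<^sup>2 * ip (r i) (r j)"
      using orth ij by (intro cond_exp_comb_mult_orthogonal) auto
    ultimately show ?thesis by eventually_elim simp
  qed
  \<comment> \<open>Finitely many exceptional null sets are merged, so that the matrices agree as a
    whole.\<close>
  then have "AE \<omega> in M. \<forall>i\<in>{..<p}. \<forall>j\<in>{..<p}.
      real_cond_exp M F (\<lambda>\<omega>. D i \<omega> * D j \<omega>) \<omega> = \<sigma>\<^sup>2 * ip (r i) (r j)"
    by (intro AE_finite_allI) auto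
  then show ?thesis
  proof eventually_elim
    case (elim \<omega>)
    then show ?case
      unfolding cond_cov_def Let_def F_def[symmetric]
      by (intro eq_matI) (auto simp: D_def)
  qed
qed

end

section \<open>Least squares\<close>

text \<open>Testing at \<open>e = b / (c + 1)\<close> turns the inequality into
  \<open>e\<^sup>2 * (c + 2) \<le> 0\<close>. The added 1 keeps the denominator positive when
  \<open>c = 0\<close>.\<close>

lemma linear_le_quadratic_imp_zero:
  fixes b c :: real
  assumes "c \<ge> 0" "\<And>e. 2 * e * b \<le> e\<^sup>2 * c"
  shows "b = 0"
proof (rule ccontr)
  assume "b \<noteq> 0"
  define t where "t = b / (c + 1)"
  have b: "b = t * (c + 1)" using assms(1) by (simp add: t_def)
  have "2 * t * b \<le> t\<^sup>2 * c" by (rule assms(2))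
  then have "t\<^sup>2 * (c + 2) \<le> 0" by (simp add: b power2_eq_square algebra_simps)
  moreover have "t\<^sup>2 > 0" using \<open>b \<noteq> 0\<close> b by auto
  ultimately show False using assms(1) by (simp add: mult_le_0_iff)
qed

text \<open>Row \<open>r = k * n + i\<close> of a stacked object corresponds to the pair
  \<open>(k, i)\<close>, the index used for the noise.\<close>

lemma sum_div_mod:
  fixes f :: "nat \<Rightarrow> nat \<Rightarrow> 'b :: comm_monoid_add"
  shows "(\<Sum>r<N * n. f (r div n) (r mod n)) = (\<Sum>(k, i)\<in>{..<N} \<times> {..<n}. f k i)"
proof (rule sum.reindex_bij_witness[where i = "\<lambda>(k, i). k * n + i" and j = "\<lambda>r. (r div n, r mod n)"])
  fix r assume r: "r \<in> {..<N * n}"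
  then have "n > 0" by (cases n) auto
  then show "(r div n, r mod n) \<in> {..<N} \<times> {..<n}"
    using r by (simp add: less_mult_imp_div_less)
next
  fix a assume a: "a \<in> {..<N} \<times> {..<n}"
  obtain k i where ki: "a = (k, i)" "k < N" "i < n" using a by auto
  have "k * n + i < Suc k * n" using ki by simp
  also have "\<dots> \<le> N * n" using ki by (intro mult_le_mono1) auto
  finally show "(case a of (k, i) \<Rightarrow> k * n + i) \<in> {..<N * n}" using ki by simp
  show "((case a of (k, i) \<Rightarrow> k * n + i) div n, (case a of (k, i) \<Rightarrow> k * n + i) mod n) = a"
    using ki by simp
qed auto

text \<open>\<open>obs A j (k, i)\<close> is the entry of the observability matrix in row \<open>k * n + i\<close> and column \<open>j\<close>.\<close>

definition obs :: "real mat \<Rightarrow> nat \<Rightarrow> nat \<times> nat \<Rightarrow> real" where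
  "obs A j a = (A ^\<^sub>m fst a) $$ (snd a, j)"

lemma sq_norm_residual:
  assumes "z \<in> carrier_vec n"
  shows "sq_norm (stack_vec n N y - observability_matrix n A N *\<^sub>v z) =
    (\<Sum>a\<in>{..<N} \<times> {..<n}. (y (fst a) $ snd a - (\<Sum>j<n. obs A j a * z $ j))\<^sup>2)"
proof -
  have "sq_norm (stack_vec n N y - observability_matrix n A N *\<^sub>v z) =
      (\<Sum>r<N * n. (y (r div n) $ (r mod n) - (\<Sum>j<n. obs A j (r div n, r mod n) * z $ j))\<^sup>2)"
    using assms
    by (simp add: sq_norm_def scalar_prod_def stack_vec_def observability_matrix_def
        obs_def power2_eq_square atLeast0LessThan)
  also have "\<dots> = (\<Sum>(k, i)\<in>{..<N} \<times> {..<n}. (y k $ i - (\<Sum>j<n. obs A j (k, i) * z $ j))\<^sup>2)"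
    by (rule sum_div_mod)
  finally show ?thesis by (simp add: case_prod_beta)
qed

text \<open>First-order optimality without derivatives: moving the minimizer by
  \<open>\<epsilon>\<close> along the unit vector \<open>j\<close> changes the cost by
  \<open>\<epsilon>\<^sup>2 * c - 2 * \<epsilon> * b\<close>, where \<open>b\<close> is the sum in
  question. This is nonnegative for all \<open>\<epsilon>\<close>, so \<open>b = 0\<close>.\<close>

lemma least_squares_normal_equations:
  assumes ls: "least_squares_estimate n A N y xh" and j: "j < n"
  shows "(\<Sum>a\<in>{..<N} \<times> {..<n}. obs A j a * (y (fst a) $ snd a - (\<Sum>i<n. obs A i a * xh $ i))) = 0"
proof (rule linear_le_quadratic_imp_zero)
  let ?I = "{..<N} \<times> {..<n}"
  let ?e = "\<lambda>a. y (fst a) $ snd a - (\<Sum>i<n. obs A i a * xh $ i)"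
  let ?c = "\<Sum>a\<in>?I. (obs A j a)\<^sup>2"
  have xh: "xh \<in> carrier_vec n"
    using ls by (simp add: least_squares_estimate_def is_arg_min_def)
  show "?c \<ge> 0" by (intro sum_nonneg) auto
  fix \<epsilon> :: real
  let ?z = "xh + \<epsilon> \<cdot>\<^sub>v unit_vec n j"
  have z: "?z \<in> carrier_vec n" using xh by simp
  have "(\<Sum>a\<in>?I. (?e a)\<^sup>2) \<le> (\<Sum>a\<in>?I. (y (fst a) $ snd a - (\<Sum>i<n. obs A i a * ?z $ i))\<^sup>2)"
    using ls z
    unfolding least_squares_estimate_def is_arg_min_linorder sq_norm_residual[OF z, symmetric]
      sq_norm_residual[OF xh, symmetric] by blast
  also have "\<dots> = (\<Sum>a\<in>?I. (?e a - \<epsilon> * obs A j a)\<^sup>2)"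
  proof (rule sum.cong[OF refl])
    fix a
    have "(\<Sum>i<n. obs A i a * ?z $ i) =
        (\<Sum>i<n. obs A i a * xh $ i + (if i = j then \<epsilon> * obs A i a else 0))"
      using xh j by (intro sum.cong) (auto simp: algebra_simps)
    also have "\<dots> = (\<Sum>i<n. obs A i a * xh $ i) + \<epsilon> * obs A j a"
      using j by (simp add: sum.distrib)
    finally show "(y (fst a) $ snd a - (\<Sum>i<n. obs A i a * ?z $ i))\<^sup>2 = (?e a - \<epsilon> * obs A j a)\<^sup>2"
      by (simp add: diff_diff_eq)
  qed
  also have "\<dots> = (\<Sum>a\<in>?I. (?e a)\<^sup>2 - 2 * \<epsilon> * (obs A j a * ?e a) + \<epsilon>\<^sup>2 * (obs A j a)\<^sup>2)"
    by (intro sum.cong) (auto simp: power2_diff power_mult_distrib)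
  also have "\<dots> = (\<Sum>a\<in>?I. (?e a)\<^sup>2) - 2 * \<epsilon> * (\<Sum>a\<in>?I. obs A j a * ?e a) + \<epsilon>\<^sup>2 * ?c"
    by (simp only: sum.distrib sum_subtractf sum_distrib_left)
  finally show "2 * \<epsilon> * (\<Sum>a\<in>?I. obs A j a * ?e a) \<le> \<epsilon>\<^sup>2 * ?c" by simp
qed

text \<open>The entrywise form of \<open>W\<^sub>o = O\<^sup>T O\<close>: the Gramian collects the
  inner products of the columns of the observability matrix.\<close>

lemma observability_gramian_index:
  assumes "A \<in> carrier_mat n n" "i < n" "j < n"
  shows "observability_gramian n A N $$ (i, j) = (\<Sum>a\<in>{..<N} \<times> {..<n}. obs A i a * obs A j a)"
proof -
  have "((A ^\<^sub>m k)\<^sup>T * A ^\<^sub>m k) $$ (i, j) = (\<Sum>l<n. obs A i (k, l) * obs A j (k, l))" for k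
    using assms pow_carrier_mat[OF assms(1), of k]
    by (subst mat_mult_index_sum[of _ n n _ n]) (auto simp: obs_def)
  then show ?thesis
    using assms by (simp add: observability_gramian_def sum.cartesian_product case_prod_beta)
qed

text \<open>Matrix powers recurse by multiplication on the right, whereas the state equation
  multiplies by \<open>A\<close> on the left.\<close>

lemma pow_mat_Suc_left:
  assumes A: "A \<in> carrier_mat n n"
  shows "A * A ^\<^sub>m k = A ^\<^sub>m Suc k"
proof (induction k)
  case 0
  then show ?case using A by simp
next
  case (Suc k)
  have "A * A ^\<^sub>m Suc k = (A * A ^\<^sub>m k) * A"
    using assoc_mult_mat[OF A pow_carrier_mat[OF A, of k] A] by simp
  then show ?case using Suc by simp
qed

theorem proposition1:
  fixes n N :: nat
    and A W\<^sub>o :: "real mat"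
    and \<sigma> :: real
    and M :: "'a measure"
    and x :: "nat \<Rightarrow> real vec"
    and v y :: "nat \<Rightarrow> 'a \<Rightarrow> real vec"
    and xhat xtilde :: "'a \<Rightarrow> real vec"
    and Y Ybar :: "nat set"
  assumes "prob_space M"
    and "A \<in> carrier_mat n n" and "N \<ge> 1" and "\<sigma> > 0"
    and "W\<^sub>o = observability_gramian n A N" and "positive_definite n W\<^sub>o"
    and "x 0 \<in> carrier_vec n"
    and "\<And>k. Suc k < N \<Longrightarrow> x (Suc k) = A *\<^sub>v x k"
    and "\<And>k \<omega>. k < N \<Longrightarrow> \<omega> \<in> space M \<Longrightarrow> v k \<omega> \<in> carrier_vec n"
    and "jointly_gaussian M ({..<N} \<times> {..<n}) (\<lambda>(k, i) \<omega>. v k \<omega> $ i)"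
    and "\<And>k. k < N \<Longrightarrow> mean_vec M n (v k) = 0\<^sub>v n"
    and "\<And>k l. k < N \<Longrightarrow> l < N \<Longrightarrow> k \<noteq> l \<Longrightarrow> cov_mat M n (v k) (v l) = 0\<^sub>m n n"
    and "\<And>k. k < N \<Longrightarrow> cov_mat M n (v k) (v k) = \<sigma>\<^sup>2 \<cdot>\<^sub>m 1\<^sub>m n"
    and "\<And>k \<omega>. k < N \<Longrightarrow> \<omega> \<in> space M \<Longrightarrow> y k \<omega> = x k + v k \<omega>"
    and "\<And>\<omega>. \<omega> \<in> space M \<Longrightarrow> least_squares_estimate n A N (\<lambda>k. y k \<omega>) (xhat \<omega>)"
    and "\<And>\<omega>. \<omega> \<in> space M \<Longrightarrow> xtilde \<omega> = xhat \<omega> - x 0"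
    and "Y \<subseteq> {..<n}" and "Ybar = {..<n} - Y"
  shows "cov_mat M n xtilde xtilde = \<sigma>\<^sup>2 \<cdot>\<^sub>m mat_inv W\<^sub>o
    \<and> det (principal_submatrix W\<^sub>o Y) = det W\<^sub>o * det (principal_submatrix (mat_inv W\<^sub>o) Ybar)
    \<and> (AE \<omega> in M. cond_cov M (card Y) (\<lambda>\<omega>'. subvec (xtilde \<omega>') Y)
                        (card Ybar) (\<lambda>\<omega>'. subvec (xtilde \<omega>') Ybar) \<omega>
          = \<sigma>\<^sup>2 \<cdot>\<^sub>m mat_inv (principal_submatrix W\<^sub>o Y))"
proof -
  note A = assms(2) and pd = assms(6) and x0 = assms(7) and Y = assms(17) and Ybar = assms(18)
  note W = assms(5)
  interpret prob_space M by (rule assms(1))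
  let ?I = "{..<N} \<times> {..<n}"

  \<comment> \<open>The measurement noise as white noise indexed by pairs\<close>
  define \<eta> where "\<eta> = (\<lambda>(k, i) \<omega>. v k \<omega> $ i)"
  have \<eta>: "\<eta> (k, i) \<omega> = v k \<omega> $ i" for k i \<omega> by (simp add: \<eta>_def)
  have v_mean: "(\<integral>\<omega>. v k \<omega> $ i \<partial>M) = 0" if "k < N" "i < n" for k i
    using arg_cong[OF assms(11)[OF that(1)], of "\<lambda>u. u $ i"] that by (simp add: mean_vec_def)
  \<comment> \<open>Since the means vanish, covariances are plain second moments.\<close>
  have v_cov: "(\<integral>\<omega>. v k \<omega> $ i * v l \<omega> $ j \<partial>M) = cov_mat M n (v k) (v l) $$ (i, j)"
    if "k < N" "l < N" "i < n" "j < n" for k l i j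
    using that by (simp add: cov_mat_def mean_vec_def v_mean)
  interpret white_noise M ?I \<eta> \<sigma>
  proof
    show "jointly_gaussian M ?I \<eta>" using assms(10) by (simp add: \<eta>_def)
    fix a b assume "a \<in> ?I" "b \<in> ?I"
    then obtain k i l j where ab: "a = (k, i)" "b = (l, j)" "k < N" "i < n" "l < N" "j < n"
      by auto
    show "expectation (\<eta> a) = 0" using v_mean[of k i] ab by (simp add: \<eta>_def)
    show "expectation (\<lambda>\<omega>. \<eta> a \<omega> * \<eta> b \<omega>) = (if a = b then \<sigma>\<^sup>2 else 0)"
      using v_cov[of k l i j] assms(12)[of k l] assms(13)[of k] ab
      by (cases "k = l") (auto simp: \<eta>)
  qed simp

  define P where "P = mat_inv W\<^sub>o"
  have Wc: "W\<^sub>o \<in> carrier_mat n n" using pd by (simp add: positive_definite_def)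
  have nz: "det W\<^sub>o \<noteq> 0" using pd by (rule positive_definite_det_nonzero)
  note inv = mat_inv[OF Wc nz, folded P_def]
  have PW: "(\<Sum>l<n. P $$ (i, l) * W\<^sub>o $$ (l, j)) = (if i = j then 1 else 0)" if "i < n" "j < n" for i j
    using mat_mult_index_sum[OF inv(1) Wc that] inv(3) that by simp
  have obs_ip: "ip (obs A i) (obs A j) = W\<^sub>o $$ (i, j)" if "i < n" "j < n" for i j
    using that by (simp add: W observability_gramian_index[OF A] ip_def)

  \<comment> \<open>Normal equations for the estimation error\<close>
  have x_pow: "x k = A ^\<^sub>m k *\<^sub>v x 0" if "k < N" for k
    using that
  proof (induction k)
    case 0
    then show ?case using A x0 by simp
  next
    case (Suc k)
    have "A *\<^sub>v (A ^\<^sub>m k *\<^sub>v x 0) = (A * A ^\<^sub>m k) *\<^sub>v x 0"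
      using pow_carrier_mat[OF A, of k] by (intro assoc_mult_mat_vec[OF A _ x0, symmetric])
    moreover have "A * A ^\<^sub>m k = A ^\<^sub>m Suc k"
      by (rule pow_mat_Suc_left[OF A])
    ultimately show ?case using Suc assms(8)[of k] by simp
  qed
  have xt: "xtilde \<omega> \<in> carrier_vec n" if "\<omega> \<in> space M" for \<omega>
    using assms(15,16)[OF that] x0 by (simp add: least_squares_estimate_def is_arg_min_def)
  have normal: "comb (obs A j) \<omega> = (\<Sum>i<n. W\<^sub>o $$ (j, i) * xtilde \<omega> $ i)"
    if \<omega>: "\<omega> \<in> space M" and j: "j < n" for \<omega> j
  proof -
    \<comment> \<open>Since \<open>y = O x[0] + \<eta>\<close>, the residual at the estimate is the
      noise minus \<open>O\<close> applied to the error.\<close>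
    have "y (fst a) \<omega> $ snd a - (\<Sum>i<n. obs A i a * xhat \<omega> $ i) =
        \<eta> a \<omega> - (\<Sum>i<n. obs A i a * xtilde \<omega> $ i)" if a: "a \<in> ?I" for a
    proof -
      obtain k l where ak: "a = (k, l)" "k < N" "l < n" using a by auto
      have "x k $ l = (\<Sum>i<n. obs A i a * x 0 $ i)"
        using mat_vec_index_sum[OF pow_carrier_mat[OF A, of k] x0 ak(3)] x_pow[OF ak(2)] ak
        by (simp add: obs_def)
      moreover have "y k \<omega> $ l = x k $ l + v k \<omega> $ l"
        using assms(9,14)[OF ak(2) \<omega>] ak by simp
      moreover have "xtilde \<omega> $ i = xhat \<omega> $ i - x 0 $ i" if "i < n" for i
        using assms(16)[OF \<omega>] x0 that by simp
      ultimately show ?thesis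
        using ak by (simp add: \<eta> right_diff_distrib sum_subtractf)
    qed
    then have "(\<Sum>a\<in>?I. obs A j a * (\<eta> a \<omega> - (\<Sum>i<n. obs A i a * xtilde \<omega> $ i))) = 0"
      using least_squares_normal_equations[OF assms(15)[OF \<omega>] j] by simp
    then have "comb (obs A j) \<omega> = (\<Sum>a\<in>?I. \<Sum>i<n. obs A j a * obs A i a * xtilde \<omega> $ i)"
      by (simp add: comb_def right_diff_distrib sum_subtractf sum_distrib_left mult.assoc)
    also have "\<dots> = (\<Sum>i<n. ip (obs A j) (obs A i) * xtilde \<omega> $ i)"
      unfolding ip_def sum_distrib_right by (rule sum.swap)
    finally show ?thesis using j by (simp add: obs_ip)
  qed

  \<comment> \<open>The error as a linear form in the noise, and its covariance\<close>
  define b where "b j = (\<lambda>a. \<Sum>i<n. P $$ (j, i) * obs A i a)" for j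
  \<comment> \<open>The coefficients \<open>b j\<close> form row \<open>j\<close> of
    \<open>W\<^sub>o\<^sup>-\<^sup>1 O\<^sup>T\<close>; multiplying the normal equations by the
    inverse isolates entry \<open>j\<close> of the error.\<close>
  have b_comb: "comb (b j) \<omega> = xtilde \<omega> $ j" if \<omega>: "\<omega> \<in> space M" and j: "j < n" for j \<omega>
  proof -
    have "comb (b j) \<omega> = (\<Sum>i<n. \<Sum>k<n. P $$ (j, i) * W\<^sub>o $$ (i, k) * xtilde \<omega> $ k)"
      using \<omega> by (simp add: b_def comb_sum comb_scale normal sum_distrib_left mult.assoc)
    also have "\<dots> = (\<Sum>k<n. (\<Sum>i<n. P $$ (j, i) * W\<^sub>o $$ (i, k)) * xtilde \<omega> $ k)"
      unfolding sum_distrib_right by (rule sum.swap)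
    also have "\<dots> = (\<Sum>k<n. if j = k then xtilde \<omega> $ k else 0)"
      using j by (intro sum.cong) (auto simp: PW)
    finally show ?thesis using j by simp
  qed
  \<comment> \<open>Up to \<open>\<sigma>\<^sup>2\<close>, the cross covariance of the error with
    \<open>O\<^sup>T \<eta>\<close> is the identity; the orthogonality of the residual rests on
    this.\<close>
  have b_obs: "ip (b j) (obs A i) = (if j = i then 1 else 0)" if "j < n" "i < n" for i j
    using that by (simp add: b_def ip_sum_left ip_scale_left obs_ip PW)
  have b_b: "ip (b i) (b j) = P $$ (i, j)" if "i < n" "j < n" for i j
  proof -
    have "ip (b i) (b j) = (\<Sum>l<n. P $$ (i, l) * ip (b j) (obs A l))"
      by (subst b_def) (simp add: ip_sum_left ip_scale_left ip_commute)
    also have "\<dots> = (\<Sum>l<n. if j = l then P $$ (i, l) else 0)"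
      using that by (intro sum.cong) (auto simp: b_obs)
    finally show ?thesis using that by simp
  qed
  have "(\<integral>\<omega>. xtilde \<omega> $ i \<partial>M) = 0" if "i < n" for i
    using that expectation_comb[of "b i"]
    by (simp add: b_comb cong: Bochner_Integration.integral_cong)
  moreover have "(\<integral>\<omega>. xtilde \<omega> $ i * xtilde \<omega> $ j \<partial>M) = \<sigma>\<^sup>2 * P $$ (i, j)" if "i < n" "j < n" for i j
    using that expectation_comb_mult[of "b i" "b j"]
    by (simp add: b_comb b_b cong: Bochner_Integration.integral_cong)
  ultimately have cov: "cov_mat M n xtilde xtilde = \<sigma>\<^sup>2 \<cdot>\<^sub>m P"
    using inv(1) by (intro eq_matI) (auto simp: cov_mat_def mean_vec_def)

  \<comment> \<open>Conditional covariance of the selected entries\<close>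
  have Ybar': "Ybar \<subseteq> {..<n}" using Ybar by auto
  have fin: "finite Y" "finite Ybar" using Y Ybar' finite_subset by auto
  let ?p = "card Y" and ?q = "card Ybar"
  define V where "V = principal_submatrix W\<^sub>o Y"
  define Q where "Q = mat_inv V"
  have Vc: "V \<in> carrier_mat ?p ?p" unfolding V_def by (rule principal_submatrix_carrier[OF Wc Y])
  have "det V \<noteq> 0"
    unfolding V_def by (rule positive_definite_det_nonzero[OF positive_definite_principal_submatrix[OF pd Y]])
  note Qinv = mat_inv[OF Vc this, folded Q_def]
  have V: "V $$ (i, j) = W\<^sub>o $$ (pick Y i, pick Y j)" if "i < ?p" "j < ?p" for i j
    unfolding V_def by (rule principal_submatrix_index[OF Wc Y that])
  have QV: "(\<Sum>l<?p. Q $$ (i, l) * W\<^sub>o $$ (pick Y l, pick Y j)) = (if i = j then 1 else 0)"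
    if "i < ?p" "j < ?p" for i j
    using mat_mult_index_sum[OF Qinv(1) Vc that] Qinv(3) that by (simp add: V)
  \<comment> \<open>Coefficients of the residual: the inverse of the principal submatrix applied to
    the entries of \<open>O\<^sup>T \<eta>\<close> in \<open>Y\<close>.\<close>
  define r where "r i = (\<lambda>a. \<Sum>l<?p. Q $$ (i, l) * obs A (pick Y l) a)" for i
  define d where "d j = b (pick Ybar j)" for j
  interpret white_noise_observed M ?I \<eta> \<sigma> ?q d "\<lambda>\<omega>. subvec (xtilde \<omega>) Ybar"
    by unfold_locales (simp add: subvec_def d_def b_comb pick_less[OF Ybar'])
  have r_obs: "ip (r i) (obs A (pick Y j)) = (if i = j then 1 else 0)" if "i < ?p" "j < ?p" for i j
    using that by (simp add: r_def ip_sum_left ip_scale_left obs_ip pick_less[OF Y] QV)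
  have r_r: "ip (r i) (r j) = Q $$ (i, j)" if "i < ?p" "j < ?p" for i j
  proof -
    have "ip (r i) (r j) = (\<Sum>l<?p. Q $$ (i, l) * ip (r j) (obs A (pick Y l)))"
      by (subst r_def) (simp add: ip_sum_left ip_scale_left ip_commute)
    also have "\<dots> = (\<Sum>l<?p. if j = l then Q $$ (i, l) else 0)"
      using that by (intro sum.cong) (auto simp: r_obs)
    finally show ?thesis using that by simp
  qed
  \<comment> \<open>Solving the rows of the normal equations in \<open>Y\<close> for the entries of
    the error in \<open>Y\<close> leaves this multiple of the entries in \<open>Ybar\<close>; the
    minus sign comes from moving them to the other side.\<close>
  define k where "k i j = - (\<Sum>l<?p. Q $$ (i, l) * W\<^sub>o $$ (pick Y l, pick Ybar j))" for i j
  have decomp: "subvec (xtilde \<omega>) Y $ i = comb (r i) \<omega> + (\<Sum>j<?q. k i j * comb (d j) \<omega>)"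
    if \<omega>: "\<omega> \<in> space M" and i: "i < ?p" for \<omega> i
  proof -
    let ?x = "\<lambda>i. xtilde \<omega> $ i"
    have split: "(\<Sum>m<n. f m) = (\<Sum>j<?p. f (pick Y j)) + (\<Sum>j<?q. f (pick Ybar j))" for f :: "nat \<Rightarrow> real"
      using sum.subset_diff[OF Y, of f] by (simp add: sum_pick fin Ybar[symmetric])
    have "comb (r i) \<omega> = (\<Sum>m<n. \<Sum>l<?p. Q $$ (i, l) * W\<^sub>o $$ (pick Y l, m) * ?x m)"
      using \<omega> unfolding r_def
      by (subst sum.swap) (simp add: comb_sum comb_scale normal pick_less[OF Y] sum_distrib_left mult.assoc)
    also have "\<dots> = (\<Sum>m<n. (\<Sum>l<?p. Q $$ (i, l) * W\<^sub>o $$ (pick Y l, m)) * ?x m)"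
      by (simp add: sum_distrib_right)
    also have "\<dots> = (\<Sum>j<?p. (if i = j then 1 else 0) * ?x (pick Y j)) +
        (\<Sum>j<?q. - k i j * ?x (pick Ybar j))"
      unfolding split using i by (simp add: QV k_def)
    also have "(\<Sum>j<?p. (if i = j then 1 else 0) * ?x (pick Y j)) = ?x (pick Y i)"
      using i by (simp add: if_distrib[of "\<lambda>t. t * _"] cong: if_cong)
    finally show ?thesis
      using i \<omega> by (simp add: subvec_def d_def b_comb pick_less[OF Ybar'] sum_negf)
  qed
  have "AE \<omega> in M. cond_cov M ?p (\<lambda>\<omega>. subvec (xtilde \<omega>) Y) ?q (\<lambda>\<omega>. subvec (xtilde \<omega>) Ybar) \<omega> =
      mat ?p ?p (\<lambda>(i, j). \<sigma>\<^sup>2 * ip (r i) (r j))"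
  proof (rule cond_cov_orthogonal_residual)
    fix i j assume ij: "i < ?p" "j < ?q"
    \<comment> \<open>The residual uses columns in \<open>Y\<close> only and \<open>d j\<close>
      belongs to an index outside \<open>Y\<close>, so each inner product is an off-diagonal entry
      of the identity.\<close>
    have "pick Ybar j \<noteq> pick Y l" if "l < ?p" for l
      using pick_mem[OF Y that] pick_mem[OF Ybar' ij(2)] Ybar by auto
    then show "ip (r i) (d j) = 0"
      using ij by (simp add: r_def d_def ip_sum_left ip_scale_left ip_commute[of "obs A _"]
          b_obs pick_less[OF Y] pick_less[OF Ybar'] sum.neutral)
  qed (rule decomp)
  moreover have "mat ?p ?p (\<lambda>(i, j). \<sigma>\<^sup>2 * ip (r i) (r j)) = \<sigma>\<^sup>2 \<cdot>\<^sub>m Q"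
    using Qinv(1) by (intro eq_matI) (auto simp: r_r)
  ultimately show ?thesis
    using cov det_principal_submatrix_complement[OF Wc nz Y]
    by (simp add: P_def Q_def V_def Ybar)
qed

end
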